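(* Let $G$ be a locally compact group which is not compact. Then $M(G)$ contains no proper weak*-closed left ideals of finite codimension, and hence no proper finitely-generated, closed left ideals of finite codimension.
   Context: $M(G)$ is the measure algebra of complex regular Borel measures on $G$ with total variation norm and convolution, identified with the dual of $C_0(G)$; "weak*" refers to this duality and "closed" to the norm topology. A left ideal $J$ is finitely-generated if $J=M(G)*\mu_1+\cdots+M(G)*\mu_n$ for some $n\in\mathbb{N}$ and $\mu_1,\dots,\mu_n\in J$ (no closure is taken). *)

theory Defs
  imports "HOL-Analysis.Analysis" "HOL-Library.Function_Algebras"
begin

text \<open>
  The group is a type of class \<^class>\<open>topological_group_add\<close>, so the group law is written
  additively but is not assumed to be commutative.  Locally compact groups are
  Hausdorff by convention, hence the additional class \<^class>\<open>t2_space\<close>.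
\<close>

definition locally_compact_group :: "'a::{topological_group_add,t2_space} itself \<Rightarrow> bool" where
  "locally_compact_group G \<longleftrightarrow> locally_compact_space (euclidean :: 'a topology)"


section \<open>Complex regular Borel measures\<close>

text \<open>
  A complex measure is a set function that is countably additive on the Borel sets. Its values on
  non-Borel sets are fixed to be \<open>0\<close>, so that equality of measures is equality of
  functions and the linear operations are the pointwise ones of
  \<^theory>\<open>HOL-Library.Function_Algebras\<close>.
\<close>

definition complex_borel_measure :: "('a::topological_space set \<Rightarrow> complex) \<Rightarrow> bool" where
  "complex_borel_measure \<mu> \<longleftrightarrow>
     (\<forall>E. E \<notin> sets borel \<longrightarrow> \<mu> E = 0) \<and>
     (\<forall>A :: nat \<Rightarrow> 'a set. range A \<subseteq> sets borel \<longrightarrow> disjoint_family A \<longrightarrow>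
        (\<lambda>i. \<mu> (A i)) sums \<mu> (\<Union>i. A i))"

definition total_variation :: "('a::topological_space set \<Rightarrow> complex) \<Rightarrow> 'a set \<Rightarrow> ennreal" where
  "total_variation \<mu> E =
     (SUP A \<in> {A :: nat \<Rightarrow> 'a set. range A \<subseteq> sets borel \<and> disjoint_family A \<and> (\<Union>i. A i) = E}.
        \<Sum>i. ennreal (norm (\<mu> (A i))))"

definition regular_measure :: "('a::topological_space set \<Rightarrow> complex) \<Rightarrow> bool" where
  "regular_measure \<mu> \<longleftrightarrow>
     (\<forall>E \<in> sets borel.
        total_variation \<mu> E = (INF U \<in> {U. open U \<and> E \<subseteq> U}. total_variation \<mu> U) \<and>
        total_variation \<mu> E = (SUP K \<in> {K. compact K \<and> K \<subseteq> E}. total_variation \<mu> K))"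

definition measure_algebra :: "('a::topological_space set \<Rightarrow> complex) set" where
  "measure_algebra = {\<mu>. complex_borel_measure \<mu> \<and> regular_measure \<mu>}"

definition tv_norm :: "('a::topological_space set \<Rightarrow> complex) \<Rightarrow> real" where
  "tv_norm \<mu> = enn2real (total_variation \<mu> UNIV)"

definition measure_scale :: "complex \<Rightarrow> ('a set \<Rightarrow> complex) \<Rightarrow> 'a set \<Rightarrow> complex" where
  "measure_scale c \<mu> = (\<lambda>E. c * \<mu> E)"

global_interpretation meas: vector_space measure_scale
  by unfold_locales (auto simp: measure_scale_def fun_eq_iff algebra_simps)


section \<open>Integration and convolution\<close>

text \<open>
  The positive part of the Jordan decomposition of a real set function \<open>\<rho>\<close>; the
  negative part is the positive part of \<open>- \<rho>\<close>. Negative values of \<open>\<rho>\<close> do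
  not contribute to the supremum because \<^const>\<open>ennreal\<close> truncates them to \<open>0\<close>.
\<close>

definition positive_part :: "('a::topological_space set \<Rightarrow> real) \<Rightarrow> 'a measure" where
  "positive_part \<rho> =
     measure_of UNIV (sets borel) (\<lambda>E. SUP F \<in> {F \<in> sets borel. F \<subseteq> E}. ennreal (\<rho> F))"

definition measure_integral ::
  "('a::topological_space set \<Rightarrow> complex) \<Rightarrow> ('a \<Rightarrow> complex) \<Rightarrow> complex" where
  "measure_integral \<mu> f =
     ((LINT x|positive_part (\<lambda>E. Re (\<mu> E)). f x) - (LINT x|positive_part (\<lambda>E. - Re (\<mu> E)). f x)) +
     \<i> * ((LINT x|positive_part (\<lambda>E. Im (\<mu> E)). f x) - (LINT x|positive_part (\<lambda>E. - Im (\<mu> E)). f x))"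

text \<open>
  In multiplicative notation, \<open>(\<mu> * \<nu>)(E) = \<integral> \<nu>(s\<^sup>-\<^sup>1 E) d\<mu>(s)\<close>. This iterated form avoids the product
  measure on the product sigma-algebra, which need not contain \<open>{(s, t). s t \<in> E}\<close>
  if the group is not second countable. For regular \<open>\<nu>\<close> the integrand is Borel measurable.
\<close>

definition convolution ::
  "('a::topological_group_add set \<Rightarrow> complex) \<Rightarrow> ('a set \<Rightarrow> complex) \<Rightarrow> 'a set \<Rightarrow> complex" where
  "convolution \<mu> \<nu> E =
     (if E \<in> sets borel then measure_integral \<mu> (\<lambda>s. \<nu> {t. s + t \<in> E}) else 0)"


section \<open>The weak* topology and the norm topology\<close>

definition C0 :: "('a::topological_space \<Rightarrow> complex) set" where
  "C0 = {f. continuous_on UNIV f \<and> (\<forall>\<epsilon>>0. \<exists>K. compact K \<and> (\<forall>x. x \<notin> K \<longrightarrow> norm (f x) < \<epsilon>))}"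

definition weak_star_topology :: "('a::topological_space set \<Rightarrow> complex) topology" where
  "weak_star_topology =
     topology_generated_by
       {{\<mu> \<in> measure_algebra. measure_integral \<mu> f \<in> U} | f U. f \<in> C0 \<and> open U}"

definition norm_topology :: "('a::topological_space set \<Rightarrow> complex) topology" where
  "norm_topology = Metric_space.mtopology measure_algebra (\<lambda>\<mu> \<nu>. tv_norm (\<mu> - \<nu>))"


section \<open>Left ideals\<close>

definition left_ideal :: "('a::topological_group_add set \<Rightarrow> complex) set \<Rightarrow> bool" where
  "left_ideal J \<longleftrightarrow>
     J \<subseteq> measure_algebra \<and> meas.subspace J \<and>
     (\<forall>\<mu> \<in> measure_algebra. \<forall>\<nu> \<in> J. convolution \<mu> \<nu> \<in> J)"

text \<open>The quotient of the measure algebra by \<open>J\<close> is spanned by finitely many cosets.\<close>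

definition finite_codimension :: "('a::topological_space set \<Rightarrow> complex) set \<Rightarrow> bool" where
  "finite_codimension J \<longleftrightarrow>
     (\<exists>B. finite B \<and> B \<subseteq> measure_algebra \<and> measure_algebra \<subseteq> meas.span (J \<union> B))"

definition finitely_generated :: "('a::topological_group_add set \<Rightarrow> complex) set \<Rightarrow> bool" where
  "finitely_generated J \<longleftrightarrow>
     (\<exists>(n::nat) \<mu>. (\<forall>i<n. \<mu> i \<in> J) \<and>
        J = {\<Sum>i<n. convolution (\<alpha> i) (\<mu> i) | \<alpha>. \<forall>i<n. \<alpha> i \<in> measure_algebra})"

end

theory Submission
  imports Defs
begin

text \<open>
  The group is written additively, so the unit of the measure algebra is the point mass at \<open>0\<close>; a left
  ideal containing it is everything. Both parts of the theorem reach it from the same relations.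

  Let \<open>J\<close> be a left ideal of codimension \<open>d\<close>. Any \<open>d + 1\<close> point masses are linearly dependent modulo
  \<open>J\<close>, so \<open>J\<close> contains a combination of them with all coefficients bounded by \<open>1\<close> and one coefficient
  equal to \<open>1\<close> (\<open>exists_dirac_sum_in_subspace\<close>). As the group is not compact, the points can be chosen
  as far apart as desired (\<open>exists_separated_sequence\<close>), and translating the combination from the left
  moves its distinguished atom to \<open>0\<close> and all the other atoms out of a given compact set.

  Functions vanishing at infinity hardly see the distant atoms. So such combinations approximate the
  unit in the weak* topology, and a weak*-closed \<open>J\<close> contains it (\<open>weak_star_closed_left_ideal_eq\<close>).

  A norm-closed ideal generated by \<open>\<mu>\<^sub>1, \<dots>, \<mu>\<^sub>n\<close> needs more work, but no duality theory. Infinitely many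
  relations of this kind, with decreasing weights \<open>w\<^sub>k\<close> and with all atoms widely separated, have a sum
  \<open>j\<close> in \<open>J\<close>. Write \<open>j = \<alpha>\<^sub>1 * \<mu>\<^sub>1 + \<dots> + \<alpha>\<^sub>n * \<mu>\<^sub>n\<close>. Up to small tails the \<open>\<mu>\<^sub>i\<close> are carried by a compact
  set \<open>K\<close>, so convolution with them moves mass only by elements of \<open>K\<close>. Around the distinguished atom
  \<open>p\<close> of the \<open>k\<close>-th relation there is room for very many disjoint collars, each wider than \<open>K\<close>, and one
  of them carries very little of the mass of the \<open>\<alpha>\<^sub>i\<close>. Restricting the \<open>\<alpha>\<^sub>i\<close> to the inside of that
  collar isolates the atom: the restricted combination lies in \<open>J\<close> and agrees, up to an error small
  compared with \<open>w\<^sub>k\<close>, with the mass \<open>w\<^sub>k\<close> at \<open>p\<close> (\<open>isolate_atom\<close>). Translating and dividing by \<open>w\<^sub>k\<close> gives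
  elements of \<open>J\<close> that converge in norm to the unit.

  The measure theory before that supplies the estimates. The four Jordan parts of a complex measure
  are finite measures, their sum is equivalent to the total variation, and so norms can be estimated
  set by set.
\<close>

section \<open>Jordan decomposition of real set functions\<close>

text \<open>
  What the real and imaginary parts of a complex Borel measure and their negatives have in common, so
  that each Jordan part is constructed only once. Values on non-Borel sets are left open.
\<close>

definition signed_borel_measure :: "('a::topological_space set \<Rightarrow> real) \<Rightarrow> bool" where
  "signed_borel_measure \<rho> \<longleftrightarrow>
     (\<forall>A :: nat \<Rightarrow> 'a set. range A \<subseteq> sets borel \<longrightarrow> disjoint_family A \<longrightarrow>
        (\<lambda>i. \<rho> (A i)) sums \<rho> (\<Union>i. A i))"

definition jordan_sup :: "('a::topological_space set \<Rightarrow> real) \<Rightarrow> 'a set \<Rightarrow> ennreal" where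
  "jordan_sup \<rho> E = (SUP F \<in> {F \<in> sets borel. F \<subseteq> E}. ennreal (\<rho> F))"

lemma signed_empty:
  assumes "signed_borel_measure \<rho>"
  shows "\<rho> {} = 0"
proof -
  have "(\<lambda>i::nat. \<rho> {}) sums \<rho> (\<Union>i::nat. {})"
    using assms unfolding signed_borel_measure_def by (force simp: disjoint_family_on_def)
  then have "(\<lambda>i::nat. \<rho> {}) \<longlonglongrightarrow> 0"
    by (intro summable_LIMSEQ_zero) (auto simp: sums_iff)
  then show ?thesis by (simp add: LIMSEQ_const_iff)
qed

lemma signed_Un:
  assumes "signed_borel_measure \<rho>" "A \<in> sets borel" "B \<in> sets borel" "A \<inter> B = {}"
  shows "\<rho> (A \<union> B) = \<rho> A + \<rho> B"
proof -
  have "disjoint_family (binaryset A B)"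
    using assms(4) by (auto simp: disjoint_family_on_def binaryset_def)
  moreover have "range (binaryset A B) \<subseteq> sets borel"
    using assms by (auto simp: range_binaryset_eq)
  ultimately have "(\<lambda>i. \<rho> (binaryset A B i)) sums \<rho> (\<Union>i. binaryset A B i)"
    using assms(1) unfolding signed_borel_measure_def by blast
  then have "(\<lambda>i. \<rho> (binaryset A B i)) sums \<rho> (A \<union> B)"
    by (simp add: UN_binaryset_eq)
  moreover have "(\<lambda>i. \<rho> (binaryset A B i)) sums (\<rho> A + \<rho> B)"
    by (rule binaryset_sums) (rule signed_empty[OF assms(1)])
  ultimately show ?thesis by (rule sums_unique2)
qed

lemma signed_Diff:
  assumes "signed_borel_measure \<rho>" "A \<in> sets borel" "B \<in> sets borel" "A \<subseteq> B"
  shows "\<rho> (B - A) = \<rho> B - \<rho> A"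
proof -
  have "A \<union> (B - A) = B" using assms(4) by auto
  then show ?thesis
    using signed_Un[OF assms(1), of A "B - A"] assms by auto
qed

lemma signed_uminus:
  assumes "signed_borel_measure \<rho>"
  shows "signed_borel_measure (\<lambda>E. - \<rho> E)"
  using assms unfolding signed_borel_measure_def by (auto intro: sums_minus)

lemma jordan_sup_upper:
  assumes "F \<in> sets borel" "F \<subseteq> E"
  shows "ennreal (\<rho> F) \<le> jordan_sup \<rho> E"
  unfolding jordan_sup_def using assms by (intro SUP_upper) auto

lemma jordan_sup_least:
  assumes "\<And>F. F \<in> sets borel \<Longrightarrow> F \<subseteq> E \<Longrightarrow> ennreal (\<rho> F) \<le> c"
  shows "jordan_sup \<rho> E \<le> c"
  unfolding jordan_sup_def using assms by (intro SUP_least) auto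

lemma jordan_sup_mono: "E \<subseteq> E' \<Longrightarrow> jordan_sup \<rho> E \<le> jordan_sup \<rho> E'"
  by (intro jordan_sup_least jordan_sup_upper) auto

text \<open>
  Sets nearly attaining the two suprema can be joined because they are disjoint. A set of negative
  value counts as \<open>0\<close>, so in that case the other set alone does the job.
\<close>

lemma jordan_sup_superadditive:
  assumes \<rho>: "signed_borel_measure \<rho>" and "A \<inter> B = {}"
  shows "jordan_sup \<rho> A + jordan_sup \<rho> B \<le> jordan_sup \<rho> (A \<union> B)"
proof -
  have *: "ennreal (\<rho> F) + ennreal (\<rho> G) \<le> jordan_sup \<rho> (A \<union> B)"
    if F: "F \<in> sets borel" "F \<subseteq> A" and G: "G \<in> sets borel" "G \<subseteq> B" for F G
  proof (cases "\<rho> F \<ge> 0 \<and> \<rho> G \<ge> 0")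
    case True
    then have "ennreal (\<rho> F) + ennreal (\<rho> G) = ennreal (\<rho> F + \<rho> G)"
      by simp
    also have "\<rho> F + \<rho> G = \<rho> (F \<union> G)"
      using F G assms by (intro signed_Un[symmetric]) auto
    also have "ennreal \<dots> \<le> jordan_sup \<rho> (A \<union> B)"
      using F G by (intro jordan_sup_upper) auto
    finally show ?thesis .
  next
    case False
    then have "ennreal (\<rho> F) + ennreal (\<rho> G) \<in> {ennreal (\<rho> F), ennreal (\<rho> G)}"
      by (auto simp: ennreal_neg)
    moreover have "ennreal (\<rho> F) \<le> jordan_sup \<rho> (A \<union> B)" "ennreal (\<rho> G) \<le> jordan_sup \<rho> (A \<union> B)"
      using F G by (auto intro!: jordan_sup_upper)
    ultimately show ?thesis by auto
  qed
  have ne: "{F \<in> sets borel. F \<subseteq> A} \<noteq> {}" "{F \<in> sets borel. F \<subseteq> B} \<noteq> {}"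
    by (auto intro: sets.empty_sets)
  have "ennreal (\<rho> F) + jordan_sup \<rho> B \<le> jordan_sup \<rho> (A \<union> B)"
    if "F \<in> sets borel" "F \<subseteq> A" for F
    unfolding jordan_sup_def[of \<rho> B] ennreal_SUP_add_right[OF ne(2)]
    using that * by (intro SUP_least) auto
  then show ?thesis
    unfolding jordan_sup_def[of \<rho> A] ennreal_SUP_add_left[OF ne(1), symmetric]
    by (intro SUP_least) auto
qed

lemma ennreal_sums_le_suminf:
  fixes r :: "nat \<Rightarrow> real"
  assumes "r sums s"
  shows "ennreal s \<le> (\<Sum>i. ennreal (r i))"
proof (rule LIMSEQ_le_const2)
  show "(\<lambda>n. ennreal (\<Sum>i<n. r i)) \<longlonglongrightarrow> ennreal s"
    using assms by (intro tendsto_ennrealI) (simp add: sums_def)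
  have "ennreal (\<Sum>i<n. r i) \<le> (\<Sum>i<n. ennreal (r i))" for n
  proof (induction n)
    case (Suc n)
    have "ennreal (a + b) \<le> ennreal a + ennreal b" for a b :: real
      by (cases "a \<ge> 0"; cases "b \<ge> 0") (auto simp: ennreal_neg intro: ennreal_leI)
    from this[of "\<Sum>i<n. r i" "r n"] show ?case
      using add_right_mono[OF Suc, of "ennreal (r n)"] by (auto intro: order_trans)
  qed auto
  moreover have "(\<Sum>i<n. ennreal (r i)) \<le> (\<Sum>i. ennreal (r i))" for n
    by (intro sum_le_suminf) auto
  ultimately show "\<exists>N. \<forall>n\<ge>N. ennreal (\<Sum>i<n. r i) \<le> (\<Sum>i. ennreal (r i))"
    using order_trans by blast
qed

lemma jordan_sup_countably_additive:
  assumes \<rho>: "signed_borel_measure \<rho>"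
  shows "countably_additive (sets borel) (jordan_sup \<rho>)"
proof (unfold countably_additive_def, intro allI impI)
  fix A :: "nat \<Rightarrow> 'a set"
  assume A: "range A \<subseteq> sets borel" "disjoint_family A"
  have fin: "(\<Sum>i<n. jordan_sup \<rho> (A i)) \<le> jordan_sup \<rho> (\<Union>i<n. A i)" for n
  proof (induction n)
    case (Suc n)
    have "(\<Sum>i<Suc n. jordan_sup \<rho> (A i)) \<le> jordan_sup \<rho> (\<Union>i<n. A i) + jordan_sup \<rho> (A n)"
      using Suc by (simp add: add_right_mono)
    also have "\<dots> \<le> jordan_sup \<rho> ((\<Union>i<n. A i) \<union> A n)"
    proof (rule jordan_sup_superadditive[OF \<rho>])
      show "(\<Union>i<n. A i) \<inter> A n = {}"
        using disjoint_family_onD[OF A(2), of _ n] by fastforce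
    qed
    also have "(\<Union>i<n. A i) \<union> A n = (\<Union>i<Suc n. A i)"
      by (auto simp: less_Suc_eq)
    finally show ?case .
  qed auto
  show "(\<Sum>i. jordan_sup \<rho> (A i)) = jordan_sup \<rho> (\<Union>i. A i)"
  proof (rule antisym)
    have "(\<Sum>i<n. jordan_sup \<rho> (A i)) \<le> jordan_sup \<rho> (\<Union>i. A i)" for n
      by (rule order_trans[OF fin]) (auto intro: jordan_sup_mono)
    then show "(\<Sum>i. jordan_sup \<rho> (A i)) \<le> jordan_sup \<rho> (\<Union>i. A i)"
      by (intro suminf_le_const) auto
    show "jordan_sup \<rho> (\<Union>i. A i) \<le> (\<Sum>i. jordan_sup \<rho> (A i))"
    proof (rule jordan_sup_least)
      fix F :: "'a set" assume F: "F \<in> sets borel" "F \<subseteq> (\<Union>i. A i)"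
      have "(\<lambda>i. \<rho> (F \<inter> A i)) sums \<rho> (\<Union>i. F \<inter> A i)"
        using \<rho>[unfolded signed_borel_measure_def, rule_format, of "\<lambda>i. F \<inter> A i"] A F
        by (auto simp: disjoint_family_on_def)
      moreover have "(\<Union>i. F \<inter> A i) = F" using F by auto
      ultimately have "ennreal (\<rho> F) \<le> (\<Sum>i. ennreal (\<rho> (F \<inter> A i)))"
        by (auto intro: ennreal_sums_le_suminf)
      also have "\<dots> \<le> (\<Sum>i. jordan_sup \<rho> (A i))"
        using A F by (intro suminf_le jordan_sup_upper) auto
      finally show "ennreal (\<rho> F) \<le> (\<Sum>i. jordan_sup \<rho> (A i))" .
    qed
  qed
qed

lemma sets_positive_part [simp, measurable_cong]: "sets (positive_part \<rho>) = sets borel"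
  using sets.sigma_sets_eq[of "borel :: 'a measure"] by (simp add: positive_part_def)

lemma space_positive_part [simp]: "space (positive_part \<rho>) = UNIV"
  unfolding positive_part_def by (subst space_measure_of) auto

lemma emeasure_positive_part:
  assumes "signed_borel_measure \<rho>" "E \<in> sets borel"
  shows "emeasure (positive_part \<rho>) E = jordan_sup \<rho> E"
  unfolding positive_part_def jordan_sup_def[symmetric]
proof (subst emeasure_measure_of_sigma)
  show "sigma_algebra UNIV (sets (borel :: 'a measure))"
    using sets.sigma_algebra_axioms[of "borel :: 'a measure"] by simp
  have "jordan_sup \<rho> {} \<le> 0"
    by (rule jordan_sup_least) (simp add: signed_empty[OF assms(1)])
  then show "positive (sets borel) (jordan_sup \<rho>)"
    by (simp add: positive_def)
qed (simp_all add: assms jordan_sup_countably_additive)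

text \<open>
  An infinite supremum on \<open>E\<close> gives \<open>F \<subseteq> E\<close> with \<open>\<rho> F > \<bar>\<rho> E\<bar> + 1\<close>, so both \<open>F\<close> and \<open>E - F\<close> have
  value at least \<open>1\<close> in modulus, and the supremum is infinite on one of them. Discarding the other
  one and repeating yields infinitely many disjoint sets whose values do not tend to \<open>0\<close>, against
  countable additivity.
\<close>

lemma jordan_sup_finite:
  assumes \<rho>: "signed_borel_measure \<rho>"
  shows "jordan_sup \<rho> UNIV < \<infinity>"
proof (rule ccontr)
  assume "\<not> jordan_sup \<rho> UNIV < \<infinity>"
  then have top: "jordan_sup \<rho> UNIV = \<infinity>" by (metis infinity_ennreal_def less_top)
  let ?P = "\<lambda>E. E \<in> sets borel \<and> jordan_sup \<rho> E = \<infinity>"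
  have step: "\<exists>A. ?P A \<and> A \<subseteq> E \<and> 1 \<le> \<bar>\<rho> (E - A)\<bar>" if E: "?P E" for E
  proof -
    have "ennreal (\<bar>\<rho> E\<bar> + 1) < jordan_sup \<rho> E" using E by (simp add: less_top)
    then obtain F where F: "F \<in> sets borel" "F \<subseteq> E" "ennreal (\<bar>\<rho> E\<bar> + 1) < ennreal (\<rho> F)"
      unfolding jordan_sup_def less_SUP_iff by auto
    then have big: "\<bar>\<rho> E\<bar> + 1 < \<rho> F" by (subst (asm) ennreal_less_iff) auto
    have diff: "\<rho> (E - F) = \<rho> E - \<rho> F" using signed_Diff[OF \<rho>] F E by auto
    have "jordan_sup \<rho> E = emeasure (positive_part \<rho>) (F \<union> (E - F))"
      using F E by (simp add: emeasure_positive_part[OF \<rho>] Un_absorb1)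
    also have "\<dots> = jordan_sup \<rho> F + jordan_sup \<rho> (E - F)"
      using F E by (subst plus_emeasure[symmetric]) (auto simp: emeasure_positive_part[OF \<rho>])
    finally have "jordan_sup \<rho> F = \<infinity> \<or> jordan_sup \<rho> (E - F) = \<infinity>"
      using E by (metis ennreal_add_eq_top infinity_ennreal_def)
    then show ?thesis
    proof
      assume "jordan_sup \<rho> F = \<infinity>"
      then show ?thesis using F diff big by (intro exI[of _ F]) auto
    next
      assume "jordan_sup \<rho> (E - F) = \<infinity>"
      moreover have "E - (E - F) = F" using F by auto
      ultimately show ?thesis using F E big by (intro exI[of _ "E - F"]) auto
    qed
  qed
  have "\<exists>S. \<forall>n. ?P (S n) \<and> (S (Suc n) \<subseteq> S n \<and> 1 \<le> \<bar>\<rho> (S n - S (Suc n))\<bar>)"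
  proof (rule dependent_nat_choice)
    show "\<exists>E. ?P E" using top by (intro exI[of _ UNIV]) auto
  qed (use step in blast)
  then obtain S where S: "\<And>n. ?P (S n)" "\<And>n. S (Suc n) \<subseteq> S n \<and> 1 \<le> \<bar>\<rho> (S n - S (Suc n))\<bar>"
    by blast
  let ?D = "\<lambda>n. S n - S (Suc n)"
  have dec: "decseq S" using S(2) by (intro decseq_SucI) auto
  have "disjoint_family ?D"
  proof (unfold disjoint_family_on_def, intro ballI impI)
    fix m n :: nat assume "m \<noteq> n"
    then consider "Suc m \<le> n" | "Suc n \<le> m" by linarith
    then show "?D m \<inter> ?D n = {}"
      using decseqD[OF dec, of "Suc m" n] decseqD[OF dec, of "Suc n" m] by cases auto
  qed
  moreover have "range ?D \<subseteq> sets borel" using S(1) by auto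
  ultimately have "(\<lambda>n. \<rho> (?D n)) sums \<rho> (\<Union>n. ?D n)"
    using \<rho> unfolding signed_borel_measure_def by blast
  then have "(\<lambda>n. \<rho> (?D n)) \<longlonglongrightarrow> 0"
    by (intro summable_LIMSEQ_zero) (auto simp: sums_iff)
  then have "\<forall>\<^sub>F n in sequentially. \<bar>\<rho> (?D n)\<bar> < 1"
    by (auto dest: tendstoD[where e = 1])
  then show False
    using S(2) by (metis (mono_tags, lifting) eventually_sequentially linorder_not_less order_refl)
qed

lemma finite_measure_positive_part:
  assumes "signed_borel_measure \<rho>"
  shows "finite_measure (positive_part \<rho>)"
  using jordan_sup_finite[OF assms]
  by (intro finite_measureI) (simp add: emeasure_positive_part[OF assms] less_top[symmetric])

text \<open>
  Passing from \<open>F \<subseteq> E\<close> to \<open>E - F\<close> turns \<open>\<rho> F\<close> into \<open>\<rho> E - \<rho> F\<close>; hence the suprema of \<open>\<rho>\<close> and of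
  \<open>- \<rho>\<close> over the subsets of \<open>E\<close> differ by \<open>\<rho> E\<close>.
\<close>

lemma jordan_decomposition:
  assumes \<rho>: "signed_borel_measure \<rho>" and E: "E \<in> sets borel"
  shows "\<rho> E = measure (positive_part \<rho>) E - measure (positive_part (\<lambda>E. - \<rho> E)) E"
proof -
  interpret P: finite_measure "positive_part \<rho>"
    by (rule finite_measure_positive_part[OF \<rho>])
  interpret N: finite_measure "positive_part (\<lambda>E. - \<rho> E)"
    by (rule finite_measure_positive_part[OF signed_uminus[OF \<rho>]])
  have *: "measure (positive_part \<sigma>) E \<le> \<sigma> E + measure (positive_part (\<lambda>E. - \<sigma> E)) E"
    if \<sigma>: "signed_borel_measure \<sigma>" for \<sigma>
  proof -
    interpret P: finite_measure "positive_part \<sigma>"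
      by (rule finite_measure_positive_part[OF \<sigma>])
    interpret N: finite_measure "positive_part (\<lambda>E. - \<sigma> E)"
      by (rule finite_measure_positive_part[OF signed_uminus[OF \<sigma>]])
    have upper: "- \<sigma> F \<le> measure (positive_part (\<lambda>E. - \<sigma> E)) E" if "F \<in> sets borel" "F \<subseteq> E" for F
      using jordan_sup_upper[OF that, of "\<lambda>E. - \<sigma> E"] E
      by (simp add: N.emeasure_eq_measure flip: emeasure_positive_part[OF signed_uminus[OF \<sigma>] E])
    have "emeasure (positive_part \<sigma>) E \<le> ennreal (\<sigma> E + measure (positive_part (\<lambda>E. - \<sigma> E)) E)"
      unfolding emeasure_positive_part[OF \<sigma> E]
    proof (rule jordan_sup_least, rule ennreal_leI)
      fix F assume F: "F \<in> sets borel" "F \<subseteq> E"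
      show "\<sigma> F \<le> \<sigma> E + measure (positive_part (\<lambda>E. - \<sigma> E)) E"
        using upper[of "E - F"] F E signed_Diff[OF \<sigma> F(1) E F(2)] by auto
    qed
    moreover have "0 \<le> \<sigma> E + measure (positive_part (\<lambda>E. - \<sigma> E)) E"
      using upper[OF E] by simp
    ultimately show ?thesis by (simp add: P.emeasure_eq_measure)
  qed
  show ?thesis
    using *[OF \<rho>] *[OF signed_uminus[OF \<rho>]] by simp
qed

section \<open>Complex measures and their variation\<close>

text \<open>
  The total mass of the four Jordan parts. It lies between the total variation and four times the
  total variation, and it is a sum of genuine finite measures, so additivity, monotonicity and
  integral estimates come for free; the estimates below are made in terms of it.
\<close>

definition jordan_variation :: "('a::topological_space set \<Rightarrow> complex) \<Rightarrow> 'a set \<Rightarrow> real" where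
  "jordan_variation \<mu> E =
     measure (positive_part (\<lambda>E. Re (\<mu> E))) E + measure (positive_part (\<lambda>E. - Re (\<mu> E))) E +
     measure (positive_part (\<lambda>E. Im (\<mu> E))) E + measure (positive_part (\<lambda>E. - Im (\<mu> E))) E"

locale complex_measure =
  fixes \<mu> :: "'a::topological_space set \<Rightarrow> complex"
  assumes complex_borel: "complex_borel_measure \<mu>"
begin

lemma null: "E \<notin> sets borel \<Longrightarrow> \<mu> E = 0"
  using complex_borel by (simp add: complex_borel_measure_def)

lemma sums_UN:
  "range A \<subseteq> sets borel \<Longrightarrow> disjoint_family A \<Longrightarrow> (\<lambda>i::nat. \<mu> (A i)) sums \<mu> (\<Union>i. A i)"
  using complex_borel by (simp add: complex_borel_measure_def)

lemma signed_Re: "signed_borel_measure (\<lambda>E. Re (\<mu> E))"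
  unfolding signed_borel_measure_def by (auto dest!: sums_UN simp: sums_complex_iff)

lemma signed_Im: "signed_borel_measure (\<lambda>E. Im (\<mu> E))"
  unfolding signed_borel_measure_def by (auto dest!: sums_UN simp: sums_complex_iff)

lemmas signed_parts = signed_Re signed_uminus[OF signed_Re] signed_Im signed_uminus[OF signed_Im]

sublocale re_pos: finite_measure "positive_part (\<lambda>E. Re (\<mu> E))"
  by (intro finite_measure_positive_part signed_parts)
sublocale re_neg: finite_measure "positive_part (\<lambda>E. - Re (\<mu> E))"
  by (intro finite_measure_positive_part signed_parts)
sublocale im_pos: finite_measure "positive_part (\<lambda>E. Im (\<mu> E))"
  by (intro finite_measure_positive_part signed_parts)
sublocale im_neg: finite_measure "positive_part (\<lambda>E. - Im (\<mu> E))"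
  by (intro finite_measure_positive_part signed_parts)

lemma decomposition:
  assumes "E \<in> sets borel"
  shows "\<mu> E = complex_of_real (measure (positive_part (\<lambda>E. Re (\<mu> E))) E - measure (positive_part (\<lambda>E. - Re (\<mu> E))) E) +
     \<i> * complex_of_real (measure (positive_part (\<lambda>E. Im (\<mu> E))) E - measure (positive_part (\<lambda>E. - Im (\<mu> E))) E)"
  using jordan_decomposition[OF signed_Re assms] jordan_decomposition[OF signed_Im assms]
  by (simp add: complex_eq_iff)

lemma Un: "A \<in> sets borel \<Longrightarrow> B \<in> sets borel \<Longrightarrow> A \<inter> B = {} \<Longrightarrow> \<mu> (A \<union> B) = \<mu> A + \<mu> B"
  using signed_Un[OF signed_Re] signed_Un[OF signed_Im] by (simp add: complex_eq_iff)

lemma empty: "\<mu> {} = 0"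
  using signed_empty[OF signed_Re] signed_empty[OF signed_Im] by (simp add: complex_eq_iff)

lemma jordan_variation_nonneg: "0 \<le> jordan_variation \<mu> E"
  by (simp add: jordan_variation_def)

lemma jordan_variation_mono:
  "A \<subseteq> B \<Longrightarrow> B \<in> sets borel \<Longrightarrow> jordan_variation \<mu> A \<le> jordan_variation \<mu> B"
  unfolding jordan_variation_def
  by (intro add_mono re_pos.finite_measure_mono re_neg.finite_measure_mono
      im_pos.finite_measure_mono im_neg.finite_measure_mono) auto

lemma jordan_variation_Diff:
  assumes "A \<in> sets borel" "B \<in> sets borel" "A \<subseteq> B"
  shows "jordan_variation \<mu> (B - A) = jordan_variation \<mu> B - jordan_variation \<mu> A"
  unfolding jordan_variation_def using assms
  by (simp add: re_pos.finite_measure_Diff re_neg.finite_measure_Diff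
      im_pos.finite_measure_Diff im_neg.finite_measure_Diff)

lemma jordan_variation_sums:
  assumes "range A \<subseteq> sets borel" "disjoint_family A"
  shows "(\<lambda>i::nat. jordan_variation \<mu> (A i)) sums jordan_variation \<mu> (\<Union>i. A i)"
  unfolding jordan_variation_def using assms
  by (intro sums_add re_pos.finite_measure_UNION re_neg.finite_measure_UNION
      im_pos.finite_measure_UNION im_neg.finite_measure_UNION) auto

lemma norm_le_jordan_variation:
  assumes "E \<in> sets borel"
  shows "norm (\<mu> E) \<le> jordan_variation \<mu> E"
proof -
  have "norm (\<mu> E) \<le> \<bar>Re (\<mu> E)\<bar> + \<bar>Im (\<mu> E)\<bar>" by (rule cmod_le)
  also have "\<dots> \<le> jordan_variation \<mu> E"
    unfolding jordan_variation_def
    using jordan_decomposition[OF signed_Re assms] jordan_decomposition[OF signed_Im assms]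
      measure_nonneg[of "positive_part (\<lambda>E. Re (\<mu> E))" E]
      measure_nonneg[of "positive_part (\<lambda>E. - Re (\<mu> E))" E]
      measure_nonneg[of "positive_part (\<lambda>E. Im (\<mu> E))" E]
      measure_nonneg[of "positive_part (\<lambda>E. - Im (\<mu> E))" E] by linarith
  finally show ?thesis .
qed

lemma norm_le_jordan_variation_superset:
  assumes "E \<subseteq> F" "F \<in> sets borel"
  shows "norm (\<mu> E) \<le> jordan_variation \<mu> F"
proof (cases "E \<in> sets borel")
  case True
  then show ?thesis
    using norm_le_jordan_variation jordan_variation_mono[OF assms] by (meson order_trans)
qed (simp add: null jordan_variation_nonneg)

text \<open>
  Each Jordan part is a supremum of real or imaginary parts of values on subsets, so a bound that holds
  set by set bounds the variation up to the factor \<open>4\<close>. This is how norms are estimated below.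
\<close>

lemma jordan_variation_le:
  assumes "E \<in> sets borel" "\<And>F. F \<in> sets borel \<Longrightarrow> F \<subseteq> E \<Longrightarrow> norm (\<mu> F) \<le> c"
  shows "jordan_variation \<mu> E \<le> 4 * c"
proof -
  have "0 \<le> c" using assms(2)[of "{}"] norm_ge_zero order_trans by (metis empty_subsetI sets.empty_sets)
  have *: "measure (positive_part \<sigma>) E \<le> c"
    if "signed_borel_measure \<sigma>" "\<And>F. \<sigma> F \<le> norm (\<mu> F)" for \<sigma>
  proof -
    have "emeasure (positive_part \<sigma>) E \<le> ennreal c"
      unfolding emeasure_positive_part[OF that(1) assms(1)]
      using that(2) assms(2) by (intro jordan_sup_least ennreal_leI) (meson order_trans)
    then show ?thesis
      using \<open>0 \<le> c\<close> by (simp add: measure_def enn2real_leI)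
  qed
  have bounds: "Re (\<mu> F) \<le> norm (\<mu> F)" "- Re (\<mu> F) \<le> norm (\<mu> F)"
    "Im (\<mu> F) \<le> norm (\<mu> F)" "- Im (\<mu> F) \<le> norm (\<mu> F)" for F
    using abs_Re_le_cmod[of "\<mu> F"] abs_Im_le_cmod[of "\<mu> F"] by linarith+
  show ?thesis
    unfolding jordan_variation_def
    using *[OF signed_parts(1) bounds(1)] *[OF signed_parts(2) bounds(2)]
      *[OF signed_parts(3) bounds(3)] *[OF signed_parts(4) bounds(4)] by linarith
qed

lemma total_variation_le_jordan_variation:
  assumes "E \<in> sets borel"
  shows "total_variation \<mu> E \<le> ennreal (jordan_variation \<mu> E)"
  unfolding total_variation_def
proof (rule SUP_least)
  fix A :: "nat \<Rightarrow> 'a set"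
  assume "A \<in> {A. range A \<subseteq> sets borel \<and> disjoint_family A \<and> (\<Union>i. A i) = E}"
  then have A: "range A \<subseteq> sets borel" "disjoint_family A" "(\<Union>i. A i) = E" by auto
  have "(\<Sum>i. ennreal (norm (\<mu> (A i)))) \<le> (\<Sum>i. ennreal (jordan_variation \<mu> (A i)))"
    using A(1) by (intro suminf_le ennreal_leI norm_le_jordan_variation) auto
  also have "\<dots> = ennreal (jordan_variation \<mu> E)"
    using jordan_variation_sums[OF A(1,2)] A(3) jordan_variation_nonneg
    by (intro suminf_ennreal_eq) auto
  finally show "(\<Sum>i. ennreal (norm (\<mu> (A i)))) \<le> ennreal (jordan_variation \<mu> E)" .
qed

lemma total_variation_finite: "E \<in> sets borel \<Longrightarrow> total_variation \<mu> E < \<infinity>"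
  by (rule le_less_trans[OF total_variation_le_jordan_variation]) auto

lemma norm_le_total_variation:
  assumes "F \<in> sets borel" "E \<in> sets borel" "F \<subseteq> E"
  shows "ennreal (norm (\<mu> F)) \<le> total_variation \<mu> E"
proof -
  have "range (binaryset F (E - F)) \<subseteq> sets borel" "disjoint_family (binaryset F (E - F))"
       "(\<Union>i. binaryset F (E - F) i) = E"
    using assms by (auto simp: range_binaryset_eq disjoint_family_on_def binaryset_def UN_binaryset_eq
        split: if_splits)
  then have "(\<Sum>i. ennreal (norm (\<mu> (binaryset F (E - F) i)))) \<le> total_variation \<mu> E"
    unfolding total_variation_def by (intro SUP_upper) auto
  moreover have "(\<Sum>i\<in>{0}. ennreal (norm (\<mu> (binaryset F (E - F) i))))
      \<le> (\<Sum>i. ennreal (norm (\<mu> (binaryset F (E - F) i))))"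
    by (intro sum_le_suminf) auto
  then have "ennreal (norm (\<mu> F)) \<le> (\<Sum>i. ennreal (norm (\<mu> (binaryset F (E - F) i))))"
    by (simp only: sum.insert finite.emptyI empty_iff not_False_eq_True sum.empty add_0_right) (simp add: binaryset_def)
  ultimately show ?thesis by (rule order_trans[rotated])
qed

lemma jordan_variation_le_total_variation:
  assumes "E \<in> sets borel"
  shows "jordan_variation \<mu> E \<le> 4 * enn2real (total_variation \<mu> E)"
proof (rule jordan_variation_le[OF assms])
  fix F :: "'a set" assume "F \<in> sets borel" "F \<subseteq> E"
  from norm_le_total_variation[OF this(1) assms this(2)]
  have "enn2real (ennreal (norm (\<mu> F))) \<le> enn2real (total_variation \<mu> E)"
    using total_variation_finite[OF assms] by (intro enn2real_mono) auto
  then show "norm (\<mu> F) \<le> enn2real (total_variation \<mu> E)" by simp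
qed

lemma norm_le_tv_norm: "norm (\<mu> E) \<le> tv_norm \<mu>"
proof (cases "E \<in> sets borel")
  case True
  then have "ennreal (norm (\<mu> E)) \<le> total_variation \<mu> UNIV"
    by (intro norm_le_total_variation) auto
  then have "enn2real (ennreal (norm (\<mu> E))) \<le> enn2real (total_variation \<mu> UNIV)"
    using total_variation_finite[of UNIV] by (intro enn2real_mono) auto
  then show ?thesis by (simp add: tv_norm_def)
qed (simp add: null tv_norm_def)

lemma tv_norm_le:
  assumes "\<And>E. E \<in> sets borel \<Longrightarrow> norm (\<mu> E) \<le> c"
  shows "tv_norm \<mu> \<le> 4 * c"
proof -
  have "tv_norm \<mu> \<le> jordan_variation \<mu> UNIV"
    unfolding tv_norm_def
    using total_variation_le_jordan_variation[of UNIV] jordan_variation_nonneg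
    by (intro enn2real_leI) auto
  also have "\<dots> \<le> 4 * c" using assms by (intro jordan_variation_le) auto
  finally show ?thesis .
qed

end

lemma complex_borel_measure_diff:
  assumes "complex_borel_measure \<mu>" "complex_borel_measure \<nu>"
  shows "complex_borel_measure (\<mu> - \<nu>)"
  unfolding complex_borel_measure_def
proof (intro conjI allI impI)
  show "(\<mu> - \<nu>) E = 0" if "E \<notin> sets borel" for E
    using assms that by (simp add: complex_borel_measure_def)
  show "(\<lambda>i. (\<mu> - \<nu>) (A i)) sums (\<mu> - \<nu>) (\<Union>i. A i)"
    if "range A \<subseteq> sets borel" "disjoint_family A" for A :: "nat \<Rightarrow> 'a set"
    unfolding fun_diff_def using assms that by (intro sums_diff) (simp_all add: complex_borel_measure_def)
qed

lemma total_variation_commute: "total_variation (\<mu> - \<nu>) E = total_variation (\<nu> - \<mu>) E"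
  unfolding total_variation_def by (simp add: norm_minus_commute)

lemma total_variation_triangle:
  "total_variation (\<mu> + \<nu>) E \<le> total_variation \<mu> E + total_variation \<nu> E"
  unfolding total_variation_def[of "\<mu> + \<nu>"]
proof (rule SUP_least)
  fix A :: "nat \<Rightarrow> 'a set"
  assume A: "A \<in> {A. range A \<subseteq> sets borel \<and> disjoint_family A \<and> (\<Union>i. A i) = E}"
  have "(\<Sum>i. ennreal (norm ((\<mu> + \<nu>) (A i))))
      \<le> (\<Sum>i. ennreal (norm (\<mu> (A i))) + ennreal (norm (\<nu> (A i))))"
  proof (intro suminf_le summableI)
    fix i
    have "ennreal (norm ((\<mu> + \<nu>) (A i))) \<le> ennreal (norm (\<mu> (A i)) + norm (\<nu> (A i)))"
      by (intro ennreal_leI) (simp add: norm_triangle_ineq)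
    then show "ennreal (norm ((\<mu> + \<nu>) (A i))) \<le> ennreal (norm (\<mu> (A i))) + ennreal (norm (\<nu> (A i)))"
      by simp
  qed
  also have "\<dots> = (\<Sum>i. ennreal (norm (\<mu> (A i)))) + (\<Sum>i. ennreal (norm (\<nu> (A i))))"
    by (intro suminf_add[symmetric]) auto
  also have "\<dots> \<le> total_variation \<mu> E + total_variation \<nu> E"
    unfolding total_variation_def using A by (intro add_mono SUP_upper)
  finally show "(\<Sum>i. ennreal (norm ((\<mu> + \<nu>) (A i)))) \<le> total_variation \<mu> E + total_variation \<nu> E" .
qed

text \<open>
  A partition of \<open>A\<close> and one of \<open>B\<close>, interleaved at even and odd indices, partition \<open>A \<union> B\<close>.
\<close>

lemma total_variation_superadditive:
  assumes AB: "A \<inter> B = {}" "A \<in> sets borel" "B \<in> sets borel"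
  shows "total_variation \<mu> A + total_variation \<mu> B \<le> total_variation \<mu> (A \<union> B)"
proof -
  let ?part = "\<lambda>E. {A :: nat \<Rightarrow> 'a set. range A \<subseteq> sets borel \<and> disjoint_family A \<and> (\<Union>i. A i) = E}"
  let ?v = "\<lambda>P. \<Sum>i. ennreal (norm (\<mu> (P i)))"
  have ne: "?part E \<noteq> {}" if "E \<in> sets borel" for E
  proof -
    have "(\<lambda>n. if n = 0 then E else {}) \<in> ?part E"
      using that by (auto simp: disjoint_family_on_def split: if_splits)
    then show ?thesis by blast
  qed
  have *: "?v P + ?v Q \<le> total_variation \<mu> (A \<union> B)" if P: "P \<in> ?part A" and Q: "Q \<in> ?part B" for P Q
  proof -
    define R where "R n = (if even n then P (n div 2) else Q (n div 2))" for n
    have PQ: "P i \<inter> Q j = {}" for i j using P Q AB(1) by blast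
    have "R m \<inter> R n = {}" if "m \<noteq> n" for m n
    proof -
      have "m div 2 \<noteq> n div 2" if "even m = even n"
        using \<open>m \<noteq> n\<close> that by (metis dvd_mult_div_cancel even_two_times_div_two odd_two_times_div_two_succ)
      moreover have "P i \<inter> P j = {}" "Q i \<inter> Q j = {}" if "i \<noteq> j" for i j
        using P Q that by (auto dest: disjoint_family_onD)
      ultimately show ?thesis
        using PQ[of "m div 2" "n div 2"] PQ[of "n div 2" "m div 2"] unfolding R_def by (auto split: if_splits)
    qed
    moreover have "(\<Union>n. R n) = A \<union> B"
    proof
      show "(\<Union>n. R n) \<subseteq> A \<union> B" using P Q by (auto simp: R_def split: if_splits)
      show "A \<union> B \<subseteq> (\<Union>n. R n)"
      proof
        fix x assume "x \<in> A \<union> B"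
        then obtain i where "x \<in> P i \<or> x \<in> Q i" using P Q by auto
        then have "x \<in> R (2 * i) \<or> x \<in> R (Suc (2 * i))" by (simp add: R_def)
        then show "x \<in> (\<Union>n. R n)" by blast
      qed
    qed
    moreover have "range R \<subseteq> sets borel"
      using P Q by (auto simp: R_def image_subset_iff)
    ultimately have R: "R \<in> ?part (A \<union> B)"
      by (simp add: disjoint_family_on_def)
    have "(\<Sum>i<n. ennreal (norm (\<mu> (P i))) + ennreal (norm (\<mu> (Q i)))) = (\<Sum>i<2*n. ennreal (norm (\<mu> (R i))))" for n
      by (induction n) (auto simp: R_def add.assoc)
    also have "(\<Sum>i<2*n. ennreal (norm (\<mu> (R i)))) \<le> ?v R" for n
      by (intro sum_le_suminf) auto
    finally have "(\<Sum>i. ennreal (norm (\<mu> (P i))) + ennreal (norm (\<mu> (Q i)))) \<le> ?v R"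
      by (intro suminf_le_const) auto
    then have "?v P + ?v Q \<le> ?v R" by (subst suminf_add) auto
    also have "?v R \<le> total_variation \<mu> (A \<union> B)"
      unfolding total_variation_def using R by (intro SUP_upper)
    finally show ?thesis .
  qed
  have "?v P + total_variation \<mu> B \<le> total_variation \<mu> (A \<union> B)" if "P \<in> ?part A" for P
    unfolding total_variation_def[of \<mu> B]
    unfolding ennreal_SUP_add_right[OF ne[OF AB(3)]] using that * by (intro SUP_least)
  then show ?thesis
    unfolding total_variation_def[of \<mu> A]
    unfolding ennreal_SUP_add_left[OF ne[OF AB(2)], symmetric] by (intro SUP_least)
qed

section \<open>The norm metric and regularity\<close>

lemma complex_measure_of_measure_algebra: "\<mu> \<in> measure_algebra \<Longrightarrow> complex_measure \<mu>"
  by (simp add: measure_algebra_def complex_measure_def)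

lemma Metric_space_measure_algebra:
  "Metric_space (measure_algebra :: ('a::topological_space set \<Rightarrow> complex) set) (\<lambda>\<mu> \<nu>. tv_norm (\<mu> - \<nu>))"
proof
  fix \<mu> \<nu> \<kappa> :: "'a set \<Rightarrow> complex"
  show "0 \<le> tv_norm (\<mu> - \<nu>)" by (simp add: tv_norm_def)
  show "tv_norm (\<mu> - \<nu>) = tv_norm (\<nu> - \<mu>)"
    by (simp add: tv_norm_def total_variation_commute[of \<mu> \<nu>])
  assume \<mu>: "\<mu> \<in> measure_algebra" and \<nu>: "\<nu> \<in> measure_algebra"
  interpret complex_measure "\<mu> - \<nu>"
    using \<mu> \<nu> by (auto simp: complex_measure_def measure_algebra_def intro: complex_borel_measure_diff)
  show "tv_norm (\<mu> - \<nu>) = 0 \<longleftrightarrow> \<mu> = \<nu>"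
  proof
    assume "tv_norm (\<mu> - \<nu>) = 0"
    then have "norm ((\<mu> - \<nu>) E) \<le> 0" for E using norm_le_tv_norm[of E] by simp
    then show "\<mu> = \<nu>" by (simp add: fun_eq_iff)
  next
    assume "\<mu> = \<nu>"
    then have "tv_norm (\<mu> - \<nu>) \<le> 4 * 0" by (intro tv_norm_le) simp
    then show "tv_norm (\<mu> - \<nu>) = 0" by (intro antisym) (simp_all add: tv_norm_def)
  qed
  assume \<kappa>: "\<kappa> \<in> measure_algebra"
  interpret K: complex_measure "\<nu> - \<kappa>"
    using \<nu> \<kappa> by (auto simp: complex_measure_def measure_algebra_def intro: complex_borel_measure_diff)
  have "enn2real (total_variation ((\<mu> - \<nu>) + (\<nu> - \<kappa>)) UNIV)
      \<le> enn2real (total_variation (\<mu> - \<nu>) UNIV + total_variation (\<nu> - \<kappa>) UNIV)"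
    using total_variation_finite[of UNIV] K.total_variation_finite[of UNIV]
    by (intro enn2real_mono total_variation_triangle) auto
  also have "\<dots> = tv_norm (\<mu> - \<nu>) + tv_norm (\<nu> - \<kappa>)"
    unfolding tv_norm_def using total_variation_finite[of UNIV] K.total_variation_finite[of UNIV]
    by (intro enn2real_plus) auto
  finally show "tv_norm (\<mu> - \<kappa>) \<le> tv_norm (\<mu> - \<nu>) + tv_norm (\<nu> - \<kappa>)"
    by (simp add: tv_norm_def)
qed

context complex_measure
begin

lemma total_variation_subadditive:
  assumes AB: "A \<inter> B = {}" "A \<in> sets borel" "B \<in> sets borel"
  shows "total_variation \<mu> (A \<union> B) \<le> total_variation \<mu> A + total_variation \<mu> B"
  unfolding total_variation_def[of \<mu> "A \<union> B"]
proof (rule SUP_least)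
  fix P :: "nat \<Rightarrow> 'a set"
  assume "P \<in> {P. range P \<subseteq> sets borel \<and> disjoint_family P \<and> (\<Union>i. P i) = A \<union> B}"
  then have P: "range P \<subseteq> sets borel" "disjoint_family P" "(\<Union>i. P i) = A \<union> B" by auto
  have split: "\<mu> (P i) = \<mu> (P i \<inter> A) + \<mu> (P i \<inter> B)" for i
  proof -
    have "P i = (P i \<inter> A) \<union> (P i \<inter> B)" using P(3) by auto
    then show ?thesis using Un[of "P i \<inter> A" "P i \<inter> B"] P(1) AB by auto
  qed
  have tv: "(\<Sum>i. ennreal (norm (\<mu> (P i \<inter> C)))) \<le> total_variation \<mu> C"
    if "C \<in> sets borel" "C \<subseteq> A \<union> B" for C
    unfolding total_variation_def using P that
    by (intro SUP_upper) (auto simp: disjoint_family_on_def)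
  have "(\<Sum>i. ennreal (norm (\<mu> (P i))))
      \<le> (\<Sum>i. ennreal (norm (\<mu> (P i \<inter> A))) + ennreal (norm (\<mu> (P i \<inter> B))))"
  proof (intro suminf_le summableI)
    fix i
    have "ennreal (norm (\<mu> (P i))) \<le> ennreal (norm (\<mu> (P i \<inter> A)) + norm (\<mu> (P i \<inter> B)))"
      unfolding split[of i] by (intro ennreal_leI norm_triangle_ineq)
    then show "ennreal (norm (\<mu> (P i))) \<le> ennreal (norm (\<mu> (P i \<inter> A))) + ennreal (norm (\<mu> (P i \<inter> B)))"
      by simp
  qed
  also have "\<dots> = (\<Sum>i. ennreal (norm (\<mu> (P i \<inter> A)))) + (\<Sum>i. ennreal (norm (\<mu> (P i \<inter> B))))"
    by (intro suminf_add[symmetric]) auto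
  also have "\<dots> \<le> total_variation \<mu> A + total_variation \<mu> B"
    using AB by (intro add_mono tv) auto
  finally show "(\<Sum>i. ennreal (norm (\<mu> (P i)))) \<le> total_variation \<mu> A + total_variation \<mu> B" .
qed

lemma total_variation_split:
  assumes "A \<subseteq> B" "A \<in> sets borel" "B \<in> sets borel"
  shows "total_variation \<mu> B = total_variation \<mu> A + total_variation \<mu> (B - A)"
proof -
  have "A \<union> (B - A) = B" using assms by auto
  then show ?thesis
    using total_variation_subadditive[of A "B - A"] total_variation_superadditive[of A "B - A" \<mu>] assms
    by (intro antisym) auto
qed

end

text \<open>
  Since the total variation is finite and additive, inner and outer regularity say exactly that the
  gap \<open>U - K\<close> can be made small; and on the gap the total variation and the Jordan variation control
  each other. Unlike the two regularity conditions, the gap condition passes at once to any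
  measure whose variation is dominated.
\<close>

lemma regular_measure_iff:
  fixes \<mu> :: "'a::t2_space set \<Rightarrow> complex"
  assumes "complex_borel_measure \<mu>"
  shows "regular_measure \<mu> \<longleftrightarrow> (\<forall>E\<in>sets borel. \<forall>\<epsilon>>0. \<exists>K U. compact K \<and> open U \<and> K \<subseteq> E \<and> E \<subseteq> U \<and>
    jordan_variation \<mu> (U - K) < \<epsilon>)"
proof -
  interpret complex_measure \<mu> using assms by (simp add: complex_measure_def)
  define t where "t E = enn2real (total_variation \<mu> E)" for E
  have t: "total_variation \<mu> E = ennreal (t E)" if "E \<in> sets borel" for E
    using total_variation_finite[OF that] by (simp add: t_def)
  have t_split: "t B = t A + t (B - A)" if "A \<subseteq> B" "A \<in> sets borel" "B \<in> sets borel" for A B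
    unfolding t_def total_variation_split[OF that]
    using total_variation_finite[OF that(2)] total_variation_finite[of "B - A"] that
    by (intro enn2real_plus) auto
  have t_nonneg: "0 \<le> t E" for E by (simp add: t_def)
  have compact_borel: "K \<in> sets borel" if "compact K" for K :: "'a set"
    using that by (intro borel_closed compact_imp_closed)
  have approx_iff: "(total_variation \<mu> E = (INF U \<in> {U. open U \<and> E \<subseteq> U}. total_variation \<mu> U) \<and>
        total_variation \<mu> E = (SUP K \<in> {K. compact K \<and> K \<subseteq> E}. total_variation \<mu> K)) \<longleftrightarrow>
      (\<forall>\<epsilon>>0. \<exists>K U. compact K \<and> open U \<and> K \<subseteq> E \<and> E \<subseteq> U \<and> jordan_variation \<mu> (U - K) < \<epsilon>)"
    (is "?inf \<and> ?sup \<longleftrightarrow> ?approx") if E: "E \<in> sets borel" for E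
  proof (intro iffI allI impI)
    fix \<epsilon> :: real assume reg: "?inf \<and> ?sup" and "\<epsilon> > 0"
    \<comment> \<open>Two defects of total variation, inner and outer, each magnified by \<open>4\<close>.\<close>
    define \<delta> where "\<delta> = \<epsilon> / 8"
    have "\<delta> > 0" using \<open>\<epsilon> > 0\<close> by (simp add: \<delta>_def)
    have "\<exists>K. compact K \<and> K \<subseteq> E \<and> t E - \<delta> < t K"
    proof (rule ccontr)
      assume "\<not> ?thesis"
      then have le: "t K \<le> t E - \<delta>" if "compact K" "K \<subseteq> E" for K using that not_less by blast
      have "0 \<le> t E - \<delta>" using le[of "{}"] t_nonneg[of "{}"] by simp
      have "ennreal (t E) \<le> ennreal (t E - \<delta>)"
        unfolding t[OF E, symmetric] conjunct2[OF reg]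
        using le by (intro SUP_least) (auto simp: t compact_borel ennreal_leI)
      then show False using \<open>0 \<le> t E - \<delta>\<close> \<open>\<delta> > 0\<close> by simp
    qed
    then obtain K where K: "compact K" "K \<subseteq> E" "t E - \<delta> < t K" by blast
    have "\<exists>U. open U \<and> E \<subseteq> U \<and> t U < t E + \<delta>"
    proof (rule ccontr)
      assume "\<not> ?thesis"
      then have le: "t E + \<delta> \<le> t U" if "open U" "E \<subseteq> U" for U using that not_less by blast
      have "ennreal (t E + \<delta>) \<le> ennreal (t E)"
        unfolding t[OF E, symmetric] conjunct1[OF reg]
        using le by (intro INF_greatest) (auto simp: t ennreal_leI)
      then show False using \<open>\<delta> > 0\<close> t_nonneg[of E] by simp
    qed
    then obtain U where U: "open U" "E \<subseteq> U" "t U < t E + \<delta>" by blast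
    have "jordan_variation \<mu> (U - K) \<le> 4 * t (U - K)"
      unfolding t_def using U K compact_borel by (intro jordan_variation_le_total_variation) auto
    also have "t (U - K) = t U - t K"
      using t_split[of K U] U K compact_borel by auto
    also have "4 * (t U - t K) < \<epsilon>" using U K by (simp add: \<delta>_def)
    finally show "\<exists>K U. compact K \<and> open U \<and> K \<subseteq> E \<and> E \<subseteq> U \<and> jordan_variation \<mu> (U - K) < \<epsilon>"
      using U K by blast
  next
    assume approx: ?approx
    have "\<exists>K U. compact K \<and> open U \<and> K \<subseteq> E \<and> E \<subseteq> U \<and> t U \<le> t E + \<epsilon> \<and> t E \<le> t K + \<epsilon>" if pos: "\<epsilon> > 0" for \<epsilon>
    proof -
      obtain K U where KU: "compact K" "open U" "K \<subseteq> E" "E \<subseteq> U" "jordan_variation \<mu> (U - K) < \<epsilon>"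
        using approx[rule_format, OF pos] by auto
      have borel: "K \<in> sets borel" "U \<in> sets borel" using KU compact_borel by auto
      have le: "t F \<le> jordan_variation \<mu> F" if "F \<in> sets borel" for F
        unfolding t_def using total_variation_le_jordan_variation[OF that] jordan_variation_nonneg
        by (intro enn2real_leI) auto
      have sub: "U - E \<subseteq> U - K" "E - K \<subseteq> U - K" using KU by auto
      have "t (U - E) \<le> \<epsilon>" "t (E - K) \<le> \<epsilon>"
        using le[of "U - E"] le[of "E - K"] KU borel E jordan_variation_mono[OF sub(1)]
          jordan_variation_mono[OF sub(2)] by auto
      then show ?thesis
        using KU t_split[OF KU(3) borel(1) E] t_split[OF KU(4) E borel(2)] by (intro exI[of _ K] exI[of _ U]) auto
    qed
    note approx = this
    have mono: "t A \<le> t B" if "A \<subseteq> B" "A \<in> sets borel" "B \<in> sets borel" for A B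
      using t_split[OF that] t_nonneg[of "B - A"] by simp
    show "?inf \<and> ?sup"
    proof (intro conjI antisym)
      show "total_variation \<mu> E \<le> (INF U \<in> {U. open U \<and> E \<subseteq> U}. total_variation \<mu> U)"
        using E by (intro INF_greatest) (auto simp: t intro!: ennreal_leI mono)
      show "(SUP K \<in> {K. compact K \<and> K \<subseteq> E}. total_variation \<mu> K) \<le> total_variation \<mu> E"
        using E by (intro SUP_least) (auto simp: t compact_borel intro!: ennreal_leI mono)
      show "(INF U \<in> {U. open U \<and> E \<subseteq> U}. total_variation \<mu> U) \<le> total_variation \<mu> E"
      proof (rule ennreal_le_epsilon)
        fix e :: real assume "e > 0"
        then obtain U where U: "open U" "E \<subseteq> U" "t U \<le> t E + e" using approx[OF \<open>e > 0\<close>] by auto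
        have "(INF U \<in> {U. open U \<and> E \<subseteq> U}. total_variation \<mu> U) \<le> total_variation \<mu> U"
          using U by (intro INF_lower) auto
        also have "\<dots> \<le> ennreal (t E + e)" using U by (simp add: t ennreal_leI)
        also have "\<dots> = total_variation \<mu> E + ennreal e"
          using \<open>e > 0\<close> t_nonneg E by (simp add: t)
        finally show "(INF U \<in> {U. open U \<and> E \<subseteq> U}. total_variation \<mu> U) \<le> total_variation \<mu> E + ennreal e" .
      qed
      show "total_variation \<mu> E \<le> (SUP K \<in> {K. compact K \<and> K \<subseteq> E}. total_variation \<mu> K)"
      proof (rule ennreal_le_epsilon)
        fix e :: real assume "e > 0"
        then obtain K where K: "compact K" "K \<subseteq> E" "t E \<le> t K + e" using approx[OF \<open>e > 0\<close>] by auto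
        have "total_variation \<mu> E \<le> ennreal (t K + e)" using K E by (simp add: t ennreal_leI)
        also have "\<dots> = total_variation \<mu> K + ennreal e"
          using \<open>e > 0\<close> t_nonneg K by (simp add: t compact_borel)
        also have "\<dots> \<le> (SUP K \<in> {K. compact K \<and> K \<subseteq> E}. total_variation \<mu> K) + ennreal e"
          using K by (intro add_right_mono SUP_upper) auto
        finally show "total_variation \<mu> E \<le> (SUP K \<in> {K. compact K \<and> K \<subseteq> E}. total_variation \<mu> K) + ennreal e" .
      qed
    qed
  qed
  show ?thesis unfolding regular_measure_def by (intro ball_cong refl) (rule approx_iff)
qed

lemma measure_algebraI:
  fixes \<mu> :: "'a::t2_space set \<Rightarrow> complex"
  assumes "complex_borel_measure \<mu>"
    and "\<And>E \<epsilon>. E \<in> sets borel \<Longrightarrow> \<epsilon> > 0 \<Longrightarrow> \<exists>K U. compact K \<and> open U \<and> K \<subseteq> E \<and> E \<subseteq> U \<and>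
      jordan_variation \<mu> (U - K) < \<epsilon>"
  shows "\<mu> \<in> measure_algebra"
  using assms regular_measure_iff[OF assms(1)] by (simp add: measure_algebra_def)

lemma measure_algebra_approximation:
  fixes \<mu> :: "'a::t2_space set \<Rightarrow> complex"
  assumes "\<mu> \<in> measure_algebra" "E \<in> sets borel" "\<epsilon> > 0"
  obtains K U where "compact K" "open U" "K \<subseteq> E" "E \<subseteq> U" "jordan_variation \<mu> (U - K) < \<epsilon>"
proof -
  have "complex_borel_measure \<mu>" "regular_measure \<mu>"
    using assms(1) by (simp_all add: measure_algebra_def)
  then have "\<exists>K U. compact K \<and> open U \<and> K \<subseteq> E \<and> E \<subseteq> U \<and> jordan_variation \<mu> (U - K) < \<epsilon>"
    using regular_measure_iff[of \<mu>] assms(2,3) by simp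
  then show ?thesis using that by auto
qed

section \<open>Integration against a complex measure\<close>

context complex_measure
begin

lemma integrable_parts:
  fixes f :: "'a \<Rightarrow> complex"
  assumes "f \<in> borel_measurable borel" "bounded (range f)"
  shows "integrable (positive_part (\<lambda>E. Re (\<mu> E))) f" "integrable (positive_part (\<lambda>E. - Re (\<mu> E))) f"
    "integrable (positive_part (\<lambda>E. Im (\<mu> E))) f" "integrable (positive_part (\<lambda>E. - Im (\<mu> E))) f"
proof -
  obtain c where c: "\<And>x. norm (f x) \<le> c" using assms(2) by (auto simp: bounded_iff)
  show "integrable (positive_part (\<lambda>E. Re (\<mu> E))) f" "integrable (positive_part (\<lambda>E. - Re (\<mu> E))) f"
    "integrable (positive_part (\<lambda>E. Im (\<mu> E))) f" "integrable (positive_part (\<lambda>E. - Im (\<mu> E))) f"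
    using assms(1) c
    by (auto intro!: re_pos.integrable_const_bound[where B = c] re_neg.integrable_const_bound[where B = c]
      im_pos.integrable_const_bound[where B = c] im_neg.integrable_const_bound[where B = c]
      simp: measurable_cong_sets[OF sets_positive_part refl])
qed

lemma measure_integral_diff:
  assumes "f \<in> borel_measurable borel" "bounded (range f)" "g \<in> borel_measurable borel" "bounded (range g)"
  shows "measure_integral \<mu> (\<lambda>x. f x - g x) = measure_integral \<mu> f - measure_integral \<mu> g"
  using integrable_parts[OF assms(1,2)] integrable_parts[OF assms(3,4)]
  by (simp add: measure_integral_def algebra_simps)

lemma measure_integral_sum_cmult:
  assumes "\<And>i. i \<in> I \<Longrightarrow> f i \<in> borel_measurable borel" "\<And>i. i \<in> I \<Longrightarrow> bounded (range (f i))"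
  shows "measure_integral \<mu> (\<lambda>x. \<Sum>i\<in>I. c i * f i x) = (\<Sum>i\<in>I. c i * measure_integral \<mu> (f i))"
  using integrable_parts[OF assms]
  by (simp add: measure_integral_def sum.distrib sum_subtractf sum_distrib_left algebra_simps)

lemma measure_integral_indicator:
  assumes "E \<in> sets borel"
  shows "measure_integral \<mu> (indicator E) = \<mu> E"
proof -
  have *: "(\<integral>x. indicator E x \<partial>M) = complex_of_real (measure M E)"
    if "sets M = sets borel" "finite_measure M" for M :: "'a measure"
  proof -
    interpret finite_measure M by fact
    have "space M = UNIV" using sets_eq_imp_space_eq[OF that(1)] by simp
    have "(\<integral>x. indicator E x \<partial>M) = (\<integral>x. complex_of_real (indicator E x) \<partial>M)"
      by (intro Bochner_Integration.integral_cong) (auto simp: indicator_def)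
    also have "\<dots> = complex_of_real (measure M E)"
      by (simp add: \<open>space M = UNIV\<close>)
    finally show ?thesis .
  qed
  show ?thesis
    unfolding measure_integral_def decomposition[OF assms]
    by (simp add: * re_pos.finite_measure_axioms re_neg.finite_measure_axioms
        im_pos.finite_measure_axioms im_neg.finite_measure_axioms)
qed

text \<open>
  The bound separates a uniformly small part \<open>c\<close> of the integrand from a large part \<open>d\<close> carried by a
  set \<open>A\<close>; it pays off when \<open>A\<close> has small variation.
\<close>

lemma norm_measure_integral_le:
  assumes f: "f \<in> borel_measurable borel" and A: "A \<in> sets borel"
    and bound: "\<And>x. norm (f x) \<le> c + d * indicator A x"
  shows "norm (measure_integral \<mu> f) \<le> c * jordan_variation \<mu> UNIV + d * jordan_variation \<mu> A"
proof -
  have *: "norm (\<integral>x. f x \<partial>M) \<le> c * measure M UNIV + d * measure M A"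
    if "sets M = sets borel" "finite_measure M" for M :: "'a measure"
  proof -
    interpret finite_measure M by fact
    have space: "space M = UNIV" using sets_eq_imp_space_eq[OF that(1)] by simp
    have ind: "integrable M (\<lambda>x. c + d * indicator A x)"
      using A that(1) by (intro Bochner_Integration.integrable_add integrable_mult_right) (auto simp: less_top[symmetric])
    have "f \<in> borel_measurable M" using f by (simp add: measurable_cong_sets[OF that(1) refl])
    then have "integrable M f"
      using bound by (intro Bochner_Integration.integrable_bound[OF ind]) (auto intro: order_trans[OF _ abs_ge_self])
    then have "norm (\<integral>x. f x \<partial>M) \<le> (\<integral>x. c + d * indicator A x \<partial>M)"
      using ind bound by (intro order_trans[OF integral_norm_bound] integral_mono) auto
    also have "\<dots> = c * measure M UNIV + d * measure M A"
      using A that(1) by (simp add: space less_top[symmetric] mult.commute)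
    finally show ?thesis .
  qed
  note parts = *[OF sets_positive_part re_pos.finite_measure_axioms] *[OF sets_positive_part re_neg.finite_measure_axioms]
    *[OF sets_positive_part im_pos.finite_measure_axioms] *[OF sets_positive_part im_neg.finite_measure_axioms]
  have "norm ((a - b) + \<i> * (p - q)) \<le> norm a + norm b + norm p + norm q" for a b p q :: complex
  proof -
    have "norm ((a - b) + \<i> * (p - q)) \<le> norm (a - b) + norm (\<i> * (p - q))" by (rule norm_triangle_ineq)
    also have "norm (\<i> * (p - q)) = norm (p - q)" by (simp add: norm_mult)
    finally show ?thesis using norm_triangle_ineq4[of a b] norm_triangle_ineq4[of p q] by linarith
  qed
  from this[of "\<integral>x. f x \<partial>positive_part (\<lambda>E. Re (\<mu> E))" "\<integral>x. f x \<partial>positive_part (\<lambda>E. - Re (\<mu> E))"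
    "\<integral>x. f x \<partial>positive_part (\<lambda>E. Im (\<mu> E))" "\<integral>x. f x \<partial>positive_part (\<lambda>E. - Im (\<mu> E))"]
  show ?thesis
    unfolding measure_integral_def[of \<mu> f] jordan_variation_def distrib_left using parts by linarith
qed

end

text \<open>
  The value on non-Borel sets is \<open>0\<close> as for every complex measure here, although \<open>E \<inter> W\<close> may be
  Borel when \<open>E\<close> is not.
\<close>

definition restrict_measure :: "'a::topological_space set \<Rightarrow> ('a set \<Rightarrow> complex) \<Rightarrow> 'a set \<Rightarrow> complex" where
  "restrict_measure W \<mu> E = (if E \<in> sets borel then \<mu> (E \<inter> W) else 0)"

text \<open>
  The subsets of \<open>E \<inter> W\<close> are the traces on \<open>W\<close> of the subsets of \<open>E\<close>, so the Jordan parts of a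
  restriction are the restricted Jordan parts.
\<close>

lemma positive_part_restrict:
  fixes \<rho> \<rho>' :: "'a::topological_space set \<Rightarrow> real"
  assumes \<rho>: "signed_borel_measure \<rho>" and \<rho>': "signed_borel_measure \<rho>'" and W: "W \<in> sets borel"
    and eq: "\<And>F. F \<in> sets borel \<Longrightarrow> \<rho>' F = \<rho> (F \<inter> W)"
  shows "positive_part \<rho>' = density (positive_part \<rho>) (\<lambda>x. ennreal (indicator W x))"
proof (rule measure_eqI)
  fix E assume "E \<in> sets (positive_part \<rho>')"
  then have E: "E \<in> sets borel" by simp
  have "jordan_sup \<rho>' E = jordan_sup \<rho> (E \<inter> W)"
  proof (intro antisym jordan_sup_least)
    fix F assume F: "F \<in> sets borel" "F \<subseteq> E"
    show "ennreal (\<rho>' F) \<le> jordan_sup \<rho> (E \<inter> W)"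
      using F W by (auto simp: eq intro!: jordan_sup_upper)
  next
    fix F assume F: "F \<in> sets borel" "F \<subseteq> E \<inter> W"
    have "F \<inter> W = F" using F by auto
    then show "ennreal (\<rho> F) \<le> jordan_sup \<rho>' E"
      using jordan_sup_upper[of F E \<rho>'] F by (simp add: eq)
  qed
  then show "emeasure (positive_part \<rho>') E
      = emeasure (density (positive_part \<rho>) (\<lambda>x. ennreal (indicator W x))) E"
    using E W by (simp add: emeasure_positive_part[OF \<rho>'] emeasure_positive_part[OF \<rho>] emeasure_density
        ennreal_indicator indicator_inter_arith[symmetric] Int_commute)
qed simp

context complex_measure
begin

lemma complex_borel_measure_restrict:
  assumes "W \<in> sets borel"
  shows "complex_borel_measure (restrict_measure W \<mu>)"
  unfolding complex_borel_measure_def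
proof (intro conjI allI impI)
  fix A :: "nat \<Rightarrow> 'a set" assume A: "range A \<subseteq> sets borel" "disjoint_family A"
  have "(\<lambda>i. \<mu> (A i \<inter> W)) sums \<mu> (\<Union>i. A i \<inter> W)"
    using A assms by (intro sums_UN) (auto simp: disjoint_family_on_def)
  moreover have "(\<Union>i. A i \<inter> W) = (\<Union>i. A i) \<inter> W" by auto
  moreover have "(\<Union>i. A i) \<in> sets borel" "\<And>i. A i \<in> sets borel" using A by auto
  ultimately show "(\<lambda>i. restrict_measure W \<mu> (A i)) sums restrict_measure W \<mu> (\<Union>i. A i)"
    by (simp add: restrict_measure_def)
qed (simp add: restrict_measure_def)

lemma positive_parts_restrict:
  assumes W: "W \<in> sets borel"
  shows
    "positive_part (\<lambda>E. Re (restrict_measure W \<mu> E)) = density (positive_part (\<lambda>E. Re (\<mu> E))) (\<lambda>x. ennreal (indicator W x))"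
    "positive_part (\<lambda>E. - Re (restrict_measure W \<mu> E)) = density (positive_part (\<lambda>E. - Re (\<mu> E))) (\<lambda>x. ennreal (indicator W x))"
    "positive_part (\<lambda>E. Im (restrict_measure W \<mu> E)) = density (positive_part (\<lambda>E. Im (\<mu> E))) (\<lambda>x. ennreal (indicator W x))"
    "positive_part (\<lambda>E. - Im (restrict_measure W \<mu> E)) = density (positive_part (\<lambda>E. - Im (\<mu> E))) (\<lambda>x. ennreal (indicator W x))"
proof -
  interpret R: complex_measure "restrict_measure W \<mu>"
    using complex_borel_measure_restrict[OF W] by (simp add: complex_measure_def)
  show "positive_part (\<lambda>E. Re (restrict_measure W \<mu> E)) = density (positive_part (\<lambda>E. Re (\<mu> E))) (\<lambda>x. ennreal (indicator W x))"
    by (rule positive_part_restrict[OF signed_parts(1) R.signed_parts(1) W]) (simp add: restrict_measure_def)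
  show "positive_part (\<lambda>E. - Re (restrict_measure W \<mu> E)) = density (positive_part (\<lambda>E. - Re (\<mu> E))) (\<lambda>x. ennreal (indicator W x))"
    by (rule positive_part_restrict[OF signed_parts(2) R.signed_parts(2) W]) (simp add: restrict_measure_def)
  show "positive_part (\<lambda>E. Im (restrict_measure W \<mu> E)) = density (positive_part (\<lambda>E. Im (\<mu> E))) (\<lambda>x. ennreal (indicator W x))"
    by (rule positive_part_restrict[OF signed_parts(3) R.signed_parts(3) W]) (simp add: restrict_measure_def)
  show "positive_part (\<lambda>E. - Im (restrict_measure W \<mu> E)) = density (positive_part (\<lambda>E. - Im (\<mu> E))) (\<lambda>x. ennreal (indicator W x))"
    by (rule positive_part_restrict[OF signed_parts(4) R.signed_parts(4) W]) (simp add: restrict_measure_def)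
qed

lemma measure_integral_restrict:
  assumes W: "W \<in> sets borel" and f: "f \<in> borel_measurable borel"
  shows "measure_integral (restrict_measure W \<mu>) f = measure_integral \<mu> (\<lambda>x. indicator W x * f x)"
proof -
  have *: "(\<integral>x. f x \<partial>density M (\<lambda>x. ennreal (indicator W x))) = (\<integral>x. indicator W x * f x \<partial>M)"
    if "sets M = sets borel" for M :: "'a measure"
  proof -
    have "(\<integral>x. f x \<partial>density M (\<lambda>x. ennreal (indicator W x))) = (\<integral>x. indicator W x *\<^sub>R f x \<partial>M)"
      using W f that by (intro integral_density) (auto simp: measurable_cong_sets[OF that refl])
    also have "\<dots> = (\<integral>x. indicator W x * f x \<partial>M)"
      by (intro Bochner_Integration.integral_cong) (auto simp: indicator_def)
    finally show ?thesis .
  qed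
  show ?thesis
    unfolding measure_integral_def positive_parts_restrict[OF W] by (simp add: *)
qed

end

lemma restrict_measure_algebra:
  fixes \<mu> :: "'a::t2_space set \<Rightarrow> complex"
  assumes \<mu>: "\<mu> \<in> measure_algebra" and W: "W \<in> sets borel"
  shows "restrict_measure W \<mu> \<in> measure_algebra"
proof -
  interpret complex_measure \<mu> by (rule complex_measure_of_measure_algebra[OF \<mu>])
  interpret R: complex_measure "restrict_measure W \<mu>"
    using complex_borel_measure_restrict[OF W] by (simp add: complex_measure_def)
  show ?thesis
  proof (rule measure_algebraI[OF R.complex_borel])
    fix E :: "'a set" and \<epsilon> :: real assume E: "E \<in> sets borel" and "\<epsilon> > 0"
    then obtain K U where KU: "compact K" "open U" "K \<subseteq> E" "E \<subseteq> U" "jordan_variation \<mu> (U - K) < \<epsilon> / 4"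
      using measure_algebra_approximation[OF \<mu> E, of "\<epsilon> / 4"] by auto
    have borel: "U - K \<in> sets borel" using KU by (intro sets.Diff borel_open borel_closed compact_imp_closed)
    have "jordan_variation (restrict_measure W \<mu>) (U - K) \<le> 4 * jordan_variation \<mu> (U - K)"
      using borel by (intro R.jordan_variation_le)
        (auto simp: restrict_measure_def intro!: norm_le_jordan_variation_superset)
    then show "\<exists>K U. compact K \<and> open U \<and> K \<subseteq> E \<and> E \<subseteq> U \<and> jordan_variation (restrict_measure W \<mu>) (U - K) < \<epsilon>"
      using KU by (intro exI[of _ K] exI[of _ U]) auto
  qed
qed

section \<open>Translates and convolution\<close>

lemma open_translate:
  fixes U :: "'a::topological_group_add set"
  assumes "open U"
  shows "open {t. s + t \<in> U}"
  using open_vimage[OF assms, of "(+) s"] by (simp add: vimage_def continuous_on_add)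

lemma borel_translate:
  fixes E :: "'a::topological_group_add set"
  assumes "E \<in> sets borel"
  shows "{t. s + t \<in> E} \<in> sets borel"
proof -
  have "(+) s \<in> borel_measurable borel"
    by (intro borel_measurable_continuous_onI continuous_intros)
  from measurable_sets[OF this assms] show ?thesis by (simp add: vimage_def)
qed

text \<open>
  For open \<open>E\<close> the function is lower semicontinuous: a compact set that carries more than \<open>a\<close> of the
  mass of the translate of \<open>E\<close> by \<open>- s\<close> stays inside the translates by all nearby elements, by the
  tube lemma. The general case follows by a Dynkin argument. Working with the addition map directly
  avoids the product sigma-algebra, for which addition need not be measurable.
\<close>

lemma measurable_measure_translate:
  fixes P :: "'a::{topological_group_add,t2_space} measure"
  assumes "finite_measure P" and sets: "sets P = sets borel"
    and inner: "\<And>U \<epsilon>. open U \<Longrightarrow> \<epsilon> > 0 \<Longrightarrow> \<exists>K. compact K \<and> K \<subseteq> U \<and> measure P (U - K) < \<epsilon>"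
    and E: "E \<in> sets borel"
  shows "(\<lambda>s. measure P {t. s + t \<in> E}) \<in> borel_measurable borel"
proof -
  interpret finite_measure P by fact
  have space: "space P = UNIV" using sets_eq_imp_space_eq[OF sets] by simp
  have "Int_stable {S :: 'a set. open S}" "{S :: 'a set. open S} \<subseteq> Pow UNIV"
    "E \<in> sigma_sets UNIV {S. open S}"
    using E by (auto simp: Int_stable_def sets_borel)
  then show ?thesis
  proof (induction rule: sigma_sets_induct_disjoint)
    case (basic U)
    then have U: "open U" by simp
    have "open {s. a < measure P {t. s + t \<in> U}}" for a
    proof (subst open_subopen, intro ballI)
      fix s0 assume "s0 \<in> {s. a < measure P {t. s + t \<in> U}}"
      then have a: "a < measure P {t. s0 + t \<in> U}" (is "a < measure P ?V") by simp
      have V: "open ?V" by (rule open_translate[OF U])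
      then obtain K where K: "compact K" "K \<subseteq> ?V" "measure P (?V - K) < measure P ?V - a"
        using inner[of ?V "measure P ?V - a"] a by auto
      have opn: "open ((\<lambda>(s, t). s + t) -` U)"
        using U by (intro open_vimage) (auto simp: case_prod_unfold intro!: continuous_intros)
      have sub: "{s0} \<times> K \<subseteq> (\<lambda>(s, t). s + t) -` U" using K(2) by auto
      obtain X where X: "s0 \<in> X" "open X" "X \<times> K \<subseteq> (\<lambda>(s, t). s + t) -` U"
        using Elementary_Topology.tube_lemma[OF K(1) opn sub] by (elim exE conjE)
      have K_borel: "K \<in> sets borel" using K by (intro borel_closed compact_imp_closed)
      have "a < measure P K"
        using K V K_borel by (simp add: finite_measure_Diff sets)
      moreover have "measure P K \<le> measure P {t. s + t \<in> U}" if "s \<in> X" for s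
        using X that open_translate[OF U, of s] by (intro finite_measure_mono) (auto simp: sets)
      ultimately show "\<exists>T. open T \<and> s0 \<in> T \<and> T \<subseteq> {s. a < measure P {t. s + t \<in> U}}"
        using X by (intro exI[of _ X]) force
    qed
    then show ?case by (intro borel_measurable_iff_greater[THEN iffD2]) simp
  next
    case (compl A)
    then have A: "A \<in> sets borel" by (simp add: sets_borel)
    have "{t. s + t \<in> UNIV - A} = space P - {t. s + t \<in> A}" for s by (auto simp: space)
    then have "measure P {t. s + t \<in> UNIV - A} = measure P (space P) - measure P {t. s + t \<in> A}" for s
      using borel_translate[OF A, of s] by (simp add: finite_measure_compl sets)
    then show ?case using compl by simp
  next
    case (union A)
    then have A: "A i \<in> sets borel" for i by (auto simp: sets_borel)
    have "{t. s + t \<in> (\<Union>i. A i)} = (\<Union>i. {t. s + t \<in> A i})" for s by auto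
    moreover have "(\<lambda>i. measure P {t. s + t \<in> A i}) sums measure P (\<Union>i. {t. s + t \<in> A i})" for s
      using borel_translate[OF A, of s] union(1)
      by (intro finite_measure_UNION) (auto simp: sets disjoint_family_on_def)
    ultimately have "measure P {t. s + t \<in> (\<Union>i. A i)} = (\<Sum>i. measure P {t. s + t \<in> A i})" for s
      by (metis sums_unique)
    then show ?case using union(3) by simp
  qed auto
qed

lemma measurable_translate:
  fixes \<mu> :: "'a::{topological_group_add,t2_space} set \<Rightarrow> complex"
  assumes \<mu>: "\<mu> \<in> measure_algebra" and E: "E \<in> sets borel"
  shows "(\<lambda>s. \<mu> {t. s + t \<in> E}) \<in> borel_measurable borel"
proof -
  interpret complex_measure \<mu> by (rule complex_measure_of_measure_algebra[OF \<mu>])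
  have inner: "\<exists>K. compact K \<and> K \<subseteq> U \<and> jordan_variation \<mu> (U - K) < \<epsilon>" if U: "open U" "\<epsilon> > 0" for U \<epsilon>
  proof -
    obtain K V where KV: "compact K" "open V" "K \<subseteq> U" "U \<subseteq> V" "jordan_variation \<mu> (V - K) < \<epsilon>"
      using measure_algebra_approximation[OF \<mu> borel_open[OF U(1)] U(2)] by auto
    have "V - K \<in> sets borel" using KV by (intro sets.Diff borel_open borel_closed compact_imp_closed)
    then have "jordan_variation \<mu> (U - K) \<le> jordan_variation \<mu> (V - K)"
      using KV by (intro jordan_variation_mono) auto
    then show ?thesis using KV by auto
  qed
  have parts: "measure (positive_part (\<lambda>E. Re (\<mu> E))) F \<le> jordan_variation \<mu> F"
    "measure (positive_part (\<lambda>E. - Re (\<mu> E))) F \<le> jordan_variation \<mu> F"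
    "measure (positive_part (\<lambda>E. Im (\<mu> E))) F \<le> jordan_variation \<mu> F"
    "measure (positive_part (\<lambda>E. - Im (\<mu> E))) F \<le> jordan_variation \<mu> F" for F
    by (simp_all add: jordan_variation_def)
  have [measurable]: "(\<lambda>s. measure (positive_part (\<lambda>E. Re (\<mu> E))) {t. s + t \<in> E}) \<in> borel_measurable borel"
    "(\<lambda>s. measure (positive_part (\<lambda>E. - Re (\<mu> E))) {t. s + t \<in> E}) \<in> borel_measurable borel"
    "(\<lambda>s. measure (positive_part (\<lambda>E. Im (\<mu> E))) {t. s + t \<in> E}) \<in> borel_measurable borel"
    "(\<lambda>s. measure (positive_part (\<lambda>E. - Im (\<mu> E))) {t. s + t \<in> E}) \<in> borel_measurable borel"
    by (intro measurable_measure_translate E re_pos.finite_measure_axioms re_neg.finite_measure_axioms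
      im_pos.finite_measure_axioms im_neg.finite_measure_axioms sets_positive_part;
      use inner parts order.strict_trans1 in meson)+
  show ?thesis
    unfolding decomposition[OF borel_translate[OF E]] by measurable
qed

lemma bounded_range_complex_measure:
  assumes "\<mu> \<in> measure_algebra"
  shows "bounded (range (\<lambda>s. \<mu> (A s)))"
proof -
  interpret complex_measure \<mu> by (rule complex_measure_of_measure_algebra[OF assms])
  show ?thesis
    unfolding bounded_iff using norm_le_jordan_variation_superset[of _ UNIV]
    by (intro exI[of _ "jordan_variation \<mu> UNIV"]) auto
qed

text \<open>
  A convolution moves mass essentially only by elements of \<open>K\<close>. With \<open>\<alpha>\<close> cut down to \<open>W\<close>, the
  convolution therefore lives on \<open>A\<close> up to \<open>\<epsilon>\<close>, and there it differs from the full convolution only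
  through the mass that \<open>\<alpha>\<close> has in the collar \<open>W' - W\<close>: mass beyond \<open>W'\<close> does not reach \<open>A\<close>.
\<close>

lemma convolution_truncation:
  fixes \<alpha> \<mu> :: "'a::{topological_group_add,t2_space} set \<Rightarrow> complex"
  assumes \<alpha>: "\<alpha> \<in> measure_algebra" and \<mu>: "\<mu> \<in> measure_algebra"
    and borel: "W \<in> sets borel" "W' \<in> sets borel" "A \<in> sets borel" "K \<in> sets borel" "E \<in> sets borel"
    and inside: "\<And>s t. s \<in> W \<Longrightarrow> t \<in> K \<Longrightarrow> s + t \<in> A"
    and outside: "\<And>s t. s \<notin> W' \<Longrightarrow> t \<in> K \<Longrightarrow> s + t \<notin> A"
    and tail: "jordan_variation \<mu> (- K) \<le> \<epsilon>"
  shows "norm (convolution (restrict_measure W \<alpha>) \<mu> E - convolution \<alpha> \<mu> (E \<inter> A))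
    \<le> \<epsilon> * jordan_variation \<alpha> UNIV + jordan_variation \<mu> UNIV * jordan_variation \<alpha> (W' - W)"
proof -
  interpret \<alpha>: complex_measure \<alpha> by (rule complex_measure_of_measure_algebra[OF \<alpha>])
  interpret \<mu>: complex_measure \<mu> by (rule complex_measure_of_measure_algebra[OF \<mu>])
  define g where "g E s = \<mu> {t. s + t \<in> E}" for E s
  have g: "g F \<in> borel_measurable borel" "bounded (range (g F))" if "F \<in> sets borel" for F
    unfolding g_def using measurable_translate[OF \<mu> that] bounded_range_complex_measure[OF \<mu>] by auto
  have EA: "E \<inter> A \<in> sets borel" using borel by auto
  have Wg: "(\<lambda>s. indicator W s * g E s) \<in> borel_measurable borel"
    using g(1)[OF borel(5)] borel(1) by measurable
  have Wb: "bounded (range (\<lambda>s. indicator W s * g E s))"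
  proof -
    obtain c where "\<And>s. norm (g E s) \<le> c" using g(2)[OF borel(5)] by (auto simp: bounded_iff)
    then have "norm (indicator W s * g E s) \<le> c" for s
      by (cases "s \<in> W") (auto intro: order_trans[OF norm_ge_zero])
    then show ?thesis by (auto simp: bounded_iff)
  qed
  have "convolution (restrict_measure W \<alpha>) \<mu> E - convolution \<alpha> \<mu> (E \<inter> A)
      = measure_integral (restrict_measure W \<alpha>) (g E) - measure_integral \<alpha> (g (E \<inter> A))"
    using borel(5) EA unfolding convolution_def g_def[abs_def] by (simp only: if_True)
  also have "\<dots> = measure_integral \<alpha> (\<lambda>s. indicator W s * g E s) - measure_integral \<alpha> (g (E \<inter> A))"
    by (simp add: \<alpha>.measure_integral_restrict borel g)
  also have "\<dots> = measure_integral \<alpha> (\<lambda>s. indicator W s * g E s - g (E \<inter> A) s)"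
    by (simp add: \<alpha>.measure_integral_diff Wg Wb g EA)
  finally have eq: "convolution (restrict_measure W \<alpha>) \<mu> E - convolution \<alpha> \<mu> (E \<inter> A)
    = measure_integral \<alpha> (\<lambda>s. indicator W s * g E s - g (E \<inter> A) s)" .
  have small: "norm (\<mu> F) \<le> \<epsilon>" if "F \<subseteq> - K" for F
    using \<mu>.norm_le_jordan_variation_superset[OF that] tail borel by auto
  have "\<epsilon> \<ge> 0" using order_trans[OF norm_ge_zero small[of "{}"]] by simp
  have "norm (indicator W s * g E s - g (E \<inter> A) s) \<le> \<epsilon> + jordan_variation \<mu> UNIV * indicator (W' - W) s" for s
  proof -
    consider "s \<in> W" | "s \<in> W' - W" | "s \<notin> W" "s \<notin> W'" by blast
    then show ?thesis
    proof cases
      case 1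
      have "{t. s + t \<in> E} = {t. s + t \<in> E \<inter> A} \<union> {t. s + t \<in> E - A}" by auto
      moreover have "\<mu> ({t. s + t \<in> E \<inter> A} \<union> {t. s + t \<in> E - A}) = g (E \<inter> A) s + g (E - A) s"
        unfolding g_def using borel EA by (intro \<mu>.Un borel_translate sets.Diff) auto
      ultimately have "g E s = g (E \<inter> A) s + g (E - A) s" by (simp only: g_def)
      moreover have "norm (g (E - A) s) \<le> \<epsilon>"
        unfolding g_def using inside[OF 1] by (intro small) auto
      ultimately show ?thesis using 1 by simp
    next
      case 2
      have "norm (g (E \<inter> A) s) \<le> jordan_variation \<mu> UNIV"
        unfolding g_def by (intro \<mu>.norm_le_jordan_variation_superset) auto
      then show ?thesis using 2 \<open>\<epsilon> \<ge> 0\<close> by simp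
    next
      case 3
      have "norm (g (E \<inter> A) s) \<le> \<epsilon>"
        unfolding g_def using outside[OF 3(2)] by (intro small) auto
      then show ?thesis using 3 by simp
    qed
  qed
  then show ?thesis
    unfolding eq using Wg g(1)[OF EA] borel
    by (intro \<alpha>.norm_measure_integral_le borel_measurable_diff) auto
qed

section \<open>Atomic measures\<close>

definition dirac :: "'a::topological_space \<Rightarrow> 'a set \<Rightarrow> complex" where
  "dirac x E = (if E \<in> sets borel then indicator E x else 0)"

text \<open>
  A measure carried by a finite set equals its own restriction to that set, and there every function
  is a combination of indicators of points.
\<close>

lemma (in complex_measure) measure_integral_concentrated:
  assumes S: "finite S" "S \<in> sets borel" "\<And>x. x \<in> S \<Longrightarrow> {x} \<in> sets borel"
    and conc: "\<And>E. E \<in> sets borel \<Longrightarrow> \<mu> E = \<mu> (E \<inter> S)"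
    and f: "f \<in> borel_measurable borel"
  shows "measure_integral \<mu> f = (\<Sum>x\<in>S. f x * \<mu> {x})"
proof -
  have "restrict_measure S \<mu> = \<mu>"
    using conc null by (auto simp: restrict_measure_def fun_eq_iff)
  then have "measure_integral \<mu> f = measure_integral \<mu> (\<lambda>x. indicator S x * f x)"
    using measure_integral_restrict[OF S(2) f] by simp
  also have "(\<lambda>x. indicator S x * f x) = (\<lambda>y. \<Sum>x\<in>S. f x * indicator {x} y)"
    using S(1) by (auto simp: fun_eq_iff indicator_def if_distrib sum.delta cong: if_cong)
  also have "measure_integral \<mu> \<dots> = (\<Sum>x\<in>S. f x * measure_integral \<mu> (indicator {x}))"
  proof (rule measure_integral_sum_cmult)
    show "bounded (range (indicator {x} :: 'a \<Rightarrow> complex))" for x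
      by (auto simp: bounded_iff indicator_def intro!: exI[of _ 1])
  qed (use S(3) in auto)
  also have "\<dots> = (\<Sum>x\<in>S. f x * \<mu> {x})"
    using S(3) by (intro sum.cong) (auto simp: measure_integral_indicator)
  finally show ?thesis .
qed

definition atomic :: "(nat \<Rightarrow> complex) \<Rightarrow> (nat \<Rightarrow> 'a::topological_space) \<Rightarrow> 'a set \<Rightarrow> complex" where
  "atomic b x E = (if E \<in> sets borel then \<Sum>m. b m * indicator E (x m) else 0)"

lemma summable_indicator_mult:
  fixes b :: "nat \<Rightarrow> complex"
  assumes "summable (\<lambda>m. norm (b m))"
  shows "summable (\<lambda>m. norm (b m * indicator E (x m)))" "summable (\<lambda>m. b m * indicator E (x m))"
proof -
  show *: "summable (\<lambda>m. norm (b m * indicator E (x m)))"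
    by (rule summable_comparison_test'[OF assms, of 0]) (auto simp: indicator_def)
  show "summable (\<lambda>m. b m * indicator E (x m))" by (rule summable_norm_cancel[OF *])
qed

text \<open>
  Exchanging the two infinite sums is an instance of Tannery's theorem, with the norms of the
  coefficients as the dominating series.
\<close>

lemma complex_borel_measure_atomic:
  assumes b: "summable (\<lambda>m. norm (b m))"
  shows "complex_borel_measure (atomic b x)"
  unfolding complex_borel_measure_def
proof (intro conjI allI impI)
  fix A :: "nat \<Rightarrow> 'a set" assume A: "range A \<subseteq> sets borel" "disjoint_family A"
  have ind: "(\<Sum>i<n. indicator (A i) y :: complex) = indicator (\<Union>i<n. A i) y" for n y
    using A(2) by (intro indicator_UN_disjoint[symmetric]) (auto simp: disjoint_family_on_def)
  have "(\<Sum>i<n. atomic b x (A i)) = (\<Sum>m. b m * (\<Sum>i<n. indicator (A i) (x m)))" for n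
  proof -
    have "(\<Sum>i<n. atomic b x (A i)) = (\<Sum>i<n. \<Sum>m. b m * indicator (A i) (x m))"
      using A(1) by (intro sum.cong) (auto simp: atomic_def)
    also have "\<dots> = (\<Sum>m. \<Sum>i<n. b m * indicator (A i) (x m))"
      by (intro suminf_sum[symmetric] summable_indicator_mult b)
    finally show ?thesis by (simp add: sum_distrib_left)
  qed
  moreover have "(\<lambda>n. \<Sum>m. b m * (\<Sum>i<n. indicator (A i) (x m))) \<longlonglongrightarrow> (\<Sum>m. b m * indicator (\<Union>i. A i) (x m))"
  proof (rule tannerys_theorem[THEN conjunct2, THEN conjunct2])
    fix m
    show "(\<lambda>n. b m * (\<Sum>i<n. indicator (A i) (x m))) \<longlonglongrightarrow> b m * indicator (\<Union>i. A i) (x m)"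
      unfolding ind by (intro tendsto_mult_left LIMSEQ_indicator_UN)
  next
    have "norm (\<Sum>i<n. indicator (A i) (x m) :: complex) \<le> 1" for n m
      unfolding ind by (simp add: indicator_def)
    then show "\<forall>\<^sub>F (m, n) in sequentially \<times>\<^sub>F sequentially.
        norm (b m * (\<Sum>i<n. indicator (A i) (x m))) \<le> norm (b m)"
      by (intro always_eventually) (auto simp: norm_mult intro!: mult_left_le)
  qed (use b in auto)
  moreover have "(\<Union>i. A i) \<in> sets borel" using A by auto
  ultimately show "(\<lambda>i. atomic b x (A i)) sums atomic b x (\<Union>i. A i)"
    by (simp add: sums_def atomic_def[of b x "\<Union>i. A i"])
qed (simp add: atomic_def)

lemma norm_atomic_minus_partial_sum_le:
  assumes b: "summable (\<lambda>m. norm (b m))" and E: "E \<in> sets borel"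
  shows "norm (atomic b x E - (\<Sum>m<M. b m * indicator E (x m))) \<le> (\<Sum>m. norm (b (m + M)))"
proof -
  have "atomic b x E - (\<Sum>m<M. b m * indicator E (x m)) = (\<Sum>m. b (m + M) * indicator E (x (m + M)))"
    using E suminf_split_initial_segment[OF summable_indicator_mult(2)[OF b], of E x M]
    by (simp add: atomic_def)
  also have "norm \<dots> \<le> (\<Sum>m. norm (b (m + M) * indicator E (x (m + M))))"
    using summable_indicator_mult(1)[OF b] by (intro summable_norm summable_ignore_initial_segment)
  also have "\<dots> \<le> (\<Sum>m. norm (b (m + M)))"
    using summable_indicator_mult(1)[OF b, of E x] b
    by (intro suminf_le summable_ignore_initial_segment[of "\<lambda>m. norm (b m * indicator E (x m))"]
        summable_ignore_initial_segment[of "\<lambda>m. norm (b m)"]) (auto simp: indicator_def)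
  finally show ?thesis .
qed

text \<open>
  Up to a small tail there are only finitely many atoms: those in \<open>E\<close> form the compact set, and
  removing the others leaves an open set containing \<open>E\<close>.
\<close>

lemma atomic_measure_algebra:
  fixes x :: "nat \<Rightarrow> 'a::t2_space"
  assumes b: "summable (\<lambda>m. norm (b m))"
  shows "atomic b x \<in> measure_algebra"
proof -
  interpret complex_measure "atomic b x"
    using complex_borel_measure_atomic[OF b] by (simp add: complex_measure_def)
  show ?thesis
  proof (rule measure_algebraI[OF complex_borel])
    fix E :: "'a set" and \<epsilon> :: real assume E: "E \<in> sets borel" and "\<epsilon> > 0"
    have "(\<lambda>M. \<Sum>m. norm (b (m + M))) \<longlonglongrightarrow> 0"
      using b by (rule suminf_exist_split2)
    then have "\<forall>\<^sub>F M in sequentially. (\<Sum>m. norm (b (m + M))) < \<epsilon> / 4"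
      using \<open>\<epsilon> > 0\<close> by (intro order_tendstoD) auto
    then obtain M where M: "(\<Sum>m. norm (b (m + M))) < \<epsilon> / 4"
      by (auto simp: eventually_sequentially)
    let ?K = "x ` {m. m < M \<and> x m \<in> E}" and ?L = "x ` {m. m < M \<and> x m \<notin> E}"
    have fin: "finite ?K" "finite ?L" by auto
    have "jordan_variation (atomic b x) (- ?L - ?K) \<le> 4 * (\<Sum>m. norm (b (m + M)))"
    proof (rule jordan_variation_le)
      show "- ?L - ?K \<in> sets borel"
        using fin by (intro sets.Diff borel_open borel_closed open_Compl finite_imp_closed)
    next
      fix F :: "'a set" assume F: "F \<in> sets borel" "F \<subseteq> - ?L - ?K"
      have "x m \<notin> F" if "m < M" for m using F(2) that by blast
      then have "(\<Sum>m<M. b m * indicator F (x m)) = 0" by (intro sum.neutral) simp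
      then show "norm (atomic b x F) \<le> (\<Sum>m. norm (b (m + M)))"
        using norm_atomic_minus_partial_sum_le[OF b F(1), of x M] by simp
    qed
    also have "\<dots> < \<epsilon>" using M by simp
    finally have "jordan_variation (atomic b x) (- ?L - ?K) < \<epsilon>" .
    moreover have "compact ?K" "open (- ?L)" "?K \<subseteq> E" "E \<subseteq> - ?L"
      using fin by (auto intro: finite_imp_compact intro!: open_Compl finite_imp_closed)
    ultimately show "\<exists>K U. compact K \<and> open U \<and> K \<subseteq> E \<and> E \<subseteq> U \<and> jordan_variation (atomic b x) (U - K) < \<epsilon>"
      by blast
  qed
qed

lemma dirac_eq_atomic: "dirac x = atomic (\<lambda>m. if m = 0 then 1 else 0) (\<lambda>_. x)"
  unfolding dirac_def atomic_def fun_eq_iff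
proof safe
  fix E
  have "(\<Sum>m::nat. (if m = 0 then 1 else 0) * indicator E x :: complex) = (\<Sum>m\<in>{0::nat}. (if m = 0 then 1 else 0) * indicator E x)"
    by (intro suminf_finite) auto
  then show "(if E \<in> sets borel then indicator E x else 0)
    = (if E \<in> sets borel then \<Sum>m. (if m = 0 then 1 else 0) * indicator E x else (0::complex))" by simp
qed

lemma dirac_measure_algebra: "dirac (x :: 'a::t2_space) \<in> measure_algebra"
  unfolding dirac_eq_atomic
proof (rule atomic_measure_algebra)
  show "summable (\<lambda>m::nat. norm (if m = 0 then 1 else 0 :: complex))"
    by (rule summable_finite[of "{0}"]) auto
qed

lemma convolution_dirac_left:
  fixes \<mu> :: "'a::{topological_group_add,t2_space} set \<Rightarrow> complex"
  assumes \<mu>: "\<mu> \<in> measure_algebra"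
  shows "convolution (dirac y) \<mu> E = (if E \<in> sets borel then \<mu> {t. y + t \<in> E} else 0)"
proof (cases "E \<in> sets borel")
  case True
  interpret complex_measure "dirac y" by (rule complex_measure_of_measure_algebra[OF dirac_measure_algebra])
  have "measure_integral (dirac y) (\<lambda>s. \<mu> {t. s + t \<in> E}) = (\<Sum>x\<in>{y}. \<mu> {t. x + t \<in> E} * dirac y {x})"
    by (rule measure_integral_concentrated) (auto simp: dirac_def indicator_def measurable_translate[OF \<mu> True])
  then show ?thesis using True by (simp add: convolution_def dirac_def)
qed (simp add: convolution_def)

lemma convolution_dirac_0_right:
  fixes \<mu> :: "'a::{topological_group_add,t2_space} set \<Rightarrow> complex"
  assumes \<mu>: "\<mu> \<in> measure_algebra"
  shows "convolution \<mu> (dirac 0) = \<mu>"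
proof
  fix E
  interpret complex_measure \<mu> by (rule complex_measure_of_measure_algebra[OF \<mu>])
  show "convolution \<mu> (dirac 0) E = \<mu> E"
  proof (cases "E \<in> sets borel")
    case True
    have "(\<lambda>s. dirac 0 {t. s + t \<in> E}) = indicator E"
      using borel_translate[OF True] by (auto simp: dirac_def indicator_def)
    then show ?thesis using True measure_integral_indicator[OF True] by (simp add: convolution_def)
  qed (simp add: convolution_def null)
qed

section \<open>Separated points and relations between point masses\<close>

definition sumset :: "'a::plus set \<Rightarrow> 'a set \<Rightarrow> 'a set" where
  "sumset A B = (\<lambda>(a, b). a + b) ` (A \<times> B)"

lemma sumsetI: "a \<in> A \<Longrightarrow> b \<in> B \<Longrightarrow> a + b \<in> sumset A B"
  by (auto simp: sumset_def)

lemma compact_sumset: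
  fixes A B :: "'a::topological_group_add set"
  assumes "compact A" "compact B"
  shows "compact (sumset A B)"
  unfolding sumset_def case_prod_unfold
  by (rule compact_continuous_image[OF _ compact_Times[OF assms]])
    (intro continuous_on_add continuous_on_fst continuous_on_snd continuous_on_id)

lemma compact_uminus_image:
  fixes A :: "'a::topological_group_add set"
  assumes "compact A"
  shows "compact (uminus ` A)"
  by (rule compact_continuous_image[OF continuous_on_minus[OF continuous_on_id] assms])

text \<open>
  The next point has to avoid finitely many compact sets, one for each of the two roles it plays
  relative to an earlier point. Their union is compact and hence not the whole group.
\<close>

lemma exists_separated_sequence:
  fixes C :: "nat \<Rightarrow> 'a::topological_group_add set"
  assumes noncompact: "\<not> compact (UNIV :: 'a set)" and C: "\<And>m. compact (C m)"
  shows "\<exists>x. \<forall>l m. l \<noteq> m \<longrightarrow> - x l + x m \<notin> C l"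
proof -
  define F where "F f m = (\<Union>l<m. sumset {f l} (C l) \<union> sumset {f l} (uminus ` C m))" for f :: "nat \<Rightarrow> 'a" and m
  have "\<exists>x. \<forall>m. x m \<notin> F x m"
  proof (rule dependent_wellorder_choice)
    show "(r \<notin> F f m) = (r \<notin> F g m)" if "\<And>l. l < m \<Longrightarrow> f l = g l" for r f g m
      using that by (simp add: F_def)
    have "compact (F f m)" for f m
      unfolding F_def using C by (intro compact_UN compact_Un compact_sumset compact_uminus_image) auto
    then show "\<exists>r. r \<notin> F f m" for m f using noncompact by (metis UNIV_I subsetI subset_UNIV subset_antisym)
  qed
  then obtain x where x: "\<And>m. x m \<notin> F x m" by blast
  have "- x l + x m \<notin> C l" if "l \<noteq> m" for l m
  proof
    assume mem: "- x l + x m \<in> C l"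
    show False
    proof (cases "l < m")
      case True
      have "x l + (- x l + x m) \<in> sumset {x l} (C l)" using mem by (intro sumsetI) auto
      then show False using x[of m] True by (auto simp: F_def add.assoc[symmetric])
    next
      case False
      have "x m + - (- x l + x m) \<in> sumset {x m} (uminus ` C l)" using mem by (intro sumsetI) auto
      moreover have "x m + - (- x l + x m) = x l" by (simp add: minus_add add.assoc[symmetric])
      ultimately show False using x[of l] False that by (auto simp: F_def)
    qed
  qed
  then show ?thesis by (intro exI[of _ x]) simp
qed

text \<open>
  The dimension bound for the quotient by \<open>J\<close>, proved by elimination: if some \<open>v r\<close> involves \<open>b\<close>,
  subtracting multiples of \<open>v r\<close> removes \<open>b\<close> from all the other vectors.
\<close>

lemma (in vector_space) combination_in_subspace:
  assumes "subspace J" "finite B" "finite I" "card B < card I" "\<And>i. i \<in> I \<Longrightarrow> v i \<in> span (J \<union> B)"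
  shows "\<exists>c. (\<exists>i\<in>I. c i \<noteq> 0) \<and> (\<Sum>i\<in>I. scale (c i) (v i)) \<in> J"
  using assms(2-5)
proof (induction B arbitrary: I v rule: finite_induct)
  case empty
  then have "v i \<in> J" if "i \<in> I" for i using that assms(1) by (simp add: span_eq_iff[THEN iffD2])
  moreover have "I \<noteq> {}" using empty by auto
  ultimately show ?case
    using assms(1) by (intro exI[of _ "\<lambda>_. 1"]) (auto intro: subspace_sum)
next
  case (insert b B)
  have "\<forall>i\<in>I. \<exists>k. v i - scale k b \<in> span (J \<union> B)"
    using insert.prems(3) by (simp add: span_breakdown_eq)
  then obtain a where a: "\<And>i. i \<in> I \<Longrightarrow> v i - scale (a i) b \<in> span (J \<union> B)" by metis
  show ?case
  proof (cases "\<forall>i\<in>I. a i = 0")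
    case True
    then show ?thesis
      using insert.IH[of I v] insert.prems insert.hyps a by auto
  next
    case False
    then obtain r where r: "r \<in> I" "a r \<noteq> 0" by blast
    define u where "u i = v i - scale (a i / a r) (v r)" for i
    have "u i \<in> span (J \<union> B)" if "i \<in> I" for i
    proof -
      have "u i = (v i - scale (a i) b) - scale (a i / a r) (v r - scale (a r) b)"
        using r by (simp add: u_def scale_right_diff_distrib)
      then show ?thesis using a[OF that] a[OF r(1)] by (auto intro: span_diff span_scale)
    qed
    then obtain c where c: "\<exists>i\<in>I - {r}. c i \<noteq> 0" "(\<Sum>i\<in>I - {r}. scale (c i) (u i)) \<in> J"
      using insert.IH[of "I - {r}" u] insert.prems insert.hyps r by fastforce
    define c' where "c' i = (if i = r then - (\<Sum>i\<in>I - {r}. c i * (a i / a r)) else c i)" for i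
    have "(\<Sum>i\<in>I. scale (c' i) (v i)) = scale (c' r) (v r) + (\<Sum>i\<in>I - {r}. scale (c' i) (v i))"
      using insert.prems r by (simp add: sum.remove)
    also have "(\<Sum>i\<in>I - {r}. scale (c' i) (v i)) = (\<Sum>i\<in>I - {r}. scale (c i) (v i))"
      by (intro sum.cong) (auto simp: c'_def)
    also have "scale (c' r) (v r) = - (\<Sum>i\<in>I - {r}. scale (c i) (scale (a i / a r) (v r)))"
      by (simp add: c'_def scale_sum_left)
    also have "\<dots> + (\<Sum>i\<in>I - {r}. scale (c i) (v i)) = (\<Sum>i\<in>I - {r}. scale (c i) (u i))"
      by (simp add: u_def scale_right_diff_distrib sum_subtractf)
    finally have "(\<Sum>i\<in>I. scale (c' i) (v i)) \<in> J" using c(2) by simp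
    moreover have "\<exists>i\<in>I. c' i \<noteq> 0" using c(1) by (auto simp: c'_def)
    ultimately show ?thesis by blast
  qed
qed

lemma sum_fun_apply: "(\<Sum>i\<in>I. f i) x = (\<Sum>i\<in>I. f i x)" for f :: "'i \<Rightarrow> 'b \<Rightarrow> 'c::comm_monoid_add"
  by (induction I rule: infinite_finite_induct) auto

definition dirac_sum :: "'i set \<Rightarrow> ('i \<Rightarrow> complex) \<Rightarrow> ('i \<Rightarrow> 'a::topological_space) \<Rightarrow> 'a set \<Rightarrow> complex" where
  "dirac_sum I c x = (\<Sum>i\<in>I. measure_scale (c i) (dirac (x i)))"

lemma dirac_sum_apply: "dirac_sum I c x E = (\<Sum>i\<in>I. c i * dirac (x i) E)"
  by (simp add: dirac_sum_def sum_fun_apply measure_scale_def)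

text \<open>
  More point masses than the codimension are linearly dependent modulo \<open>J\<close>; dividing by a
  coefficient of largest modulus normalises the relation. The uniform bound on the coefficients is
  what makes the contribution of the remaining points negligible, however these points are chosen.
\<close>

lemma exists_dirac_sum_in_subspace:
  fixes J :: "('a::t2_space set \<Rightarrow> complex) set" and x :: "'i \<Rightarrow> 'a"
  assumes J: "meas.subspace J" and B: "finite B" "measure_algebra \<subseteq> meas.span (J \<union> B)"
    and I: "finite I" "card B < card I"
  shows "\<exists>c r. r \<in> I \<and> c r = 1 \<and> (\<forall>i\<in>I. norm (c i) \<le> 1) \<and> dirac_sum I c x \<in> J"
proof -
  have "dirac (x i) \<in> meas.span (J \<union> B)" for i using B(2) dirac_measure_algebra by blast
  then obtain c i where c: "i \<in> I" "c i \<noteq> 0" "(\<Sum>i\<in>I. measure_scale (c i) (dirac (x i))) \<in> J"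
    using meas.combination_in_subspace[OF J B(1) I, of "\<lambda>i. dirac (x i)"] by auto
  have "Max ((\<lambda>i. norm (c i)) ` I) \<in> (\<lambda>i. norm (c i)) ` I" using I(1) c(1) by (intro Max_in) auto
  then obtain r where r: "r \<in> I" "norm (c r) = Max ((\<lambda>i. norm (c i)) ` I)" by auto
  have r_max: "norm (c i) \<le> norm (c r)" if "i \<in> I" for i
    unfolding r(2) using I(1) that by (intro Max_ge) auto
  have "c r \<noteq> 0" using r_max[OF c(1)] c(2) by auto
  have "dirac_sum I (\<lambda>i. c i / c r) x = measure_scale (1 / c r) (\<Sum>i\<in>I. measure_scale (c i) (dirac (x i)))"
    by (simp add: dirac_sum_def meas.scale_sum_right)
  then have "dirac_sum I (\<lambda>i. c i / c r) x \<in> J"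
    using meas.subspace_scale[OF J c(3)] by simp
  then show ?thesis
    using r(1) r_max \<open>c r \<noteq> 0\<close> by (intro exI[of _ "\<lambda>i. c i / c r"] exI[of _ r]) (auto simp: norm_divide divide_le_eq_1)
qed

lemma convolution_dirac_dirac_sum:
  fixes x :: "'i \<Rightarrow> 'a::{topological_group_add,t2_space}"
  assumes "dirac_sum I c x \<in> measure_algebra"
  shows "convolution (dirac y) (dirac_sum I c x) = dirac_sum I c (\<lambda>i. y + x i)"
proof
  fix E
  show "convolution (dirac y) (dirac_sum I c x) E = dirac_sum I c (\<lambda>i. y + x i) E"
    using borel_translate[of E y]
    by (auto simp: convolution_dirac_left[OF assms] dirac_sum_apply dirac_def indicator_def intro!: sum.cong)
qed

lemma measure_integral_dirac_sum:
  fixes x :: "'i \<Rightarrow> 'a::t2_space"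
  assumes I: "finite I" and h: "dirac_sum I c x \<in> measure_algebra" and f: "f \<in> borel_measurable borel"
  shows "measure_integral (dirac_sum I c x) f = (\<Sum>i\<in>I. c i * f (x i))"
proof -
  interpret complex_measure "dirac_sum I c x" by (rule complex_measure_of_measure_algebra[OF h])
  have S: "finite (x ` I)" "x ` I \<in> sets borel"
    using I by (simp_all add: borel_closed finite_imp_closed)
  have "measure_integral (dirac_sum I c x) f = (\<Sum>y\<in>x ` I. f y * dirac_sum I c x {y})"
  proof (rule measure_integral_concentrated[OF S _ _ f])
    fix E :: "'a set" assume "E \<in> sets borel"
    moreover from this S have "E \<inter> x ` I \<in> sets borel" by (intro sets.Int)
    ultimately show "dirac_sum I c x E = dirac_sum I c x (E \<inter> x ` I)"
      unfolding dirac_sum_apply by (intro sum.cong refl) (simp add: dirac_def indicator_def)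
  qed (simp add: borel_closed)
  also have "\<dots> = (\<Sum>y\<in>x ` I. \<Sum>i\<in>I. c i * (if x i = y then f y else 0))"
    unfolding dirac_sum_apply sum_distrib_left
    by (intro sum.cong refl) (simp add: dirac_def indicator_def)
  also have "\<dots> = (\<Sum>i\<in>I. \<Sum>y\<in>x ` I. c i * (if x i = y then f y else 0))"
    by (rule sum.swap)
  also have "\<dots> = (\<Sum>i\<in>I. c i * f (x i))"
  proof (intro sum.cong refl)
    fix i assume "i \<in> I"
    then have "(\<Sum>y\<in>x ` I. if x i = y then f y else 0) = f (x i)"
      using S(1) by (simp add: sum.delta')
    then show "(\<Sum>y\<in>x ` I. c i * (if x i = y then f y else 0)) = c i * f (x i)"
      by (simp only: sum_distrib_left[symmetric])
  qed
  finally show ?thesis .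
qed

section \<open>Weak*-closed left ideals of finite codimension\<close>

lemma left_ideal_convolution:
  "left_ideal J \<Longrightarrow> \<mu> \<in> measure_algebra \<Longrightarrow> \<nu> \<in> J \<Longrightarrow> convolution \<mu> \<nu> \<in> J"
  by (simp add: left_ideal_def)

text \<open>
  The point mass at the neutral element is the unit of the measure algebra.
\<close>

lemma left_ideal_eq_measure_algebra:
  fixes J :: "('a::{topological_group_add,t2_space} set \<Rightarrow> complex) set"
  assumes "left_ideal J" "dirac 0 \<in> J"
  shows "J = measure_algebra"
proof
  show "measure_algebra \<subseteq> J"
  proof
    fix \<mu> :: "'a set \<Rightarrow> complex" assume \<mu>: "\<mu> \<in> measure_algebra"
    show "\<mu> \<in> J"
      using left_ideal_convolution[OF assms(1) \<mu> assms(2)] by (simp add: convolution_dirac_0_right[OF \<mu>])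
  qed
  show "J \<subseteq> measure_algebra" using assms(1) by (simp add: left_ideal_def)
qed

text \<open>
  A weak* neighbourhood tests only finitely many functions vanishing at infinity. Outside a large
  compact set they are so small that at most \<open>D\<close> atoms with coefficients bounded by \<open>1\<close> go unnoticed.
  The condition on \<open>K\<close> is stable under finite intersections and arbitrary unions, so the
  argument is an induction on the generation of the topology.
\<close>

lemma weak_star_neighbourhood_of_dirac_0:
  fixes U :: "('a::{topological_group_add,t2_space} set \<Rightarrow> complex) set"
  assumes "openin weak_star_topology U" "dirac 0 \<in> U"
  shows "\<exists>K. compact K \<and> (\<forall>c x r. r < D \<longrightarrow> c r = 1 \<longrightarrow> x r = 0 \<longrightarrow> (\<forall>i<D. norm (c i) \<le> 1) \<longrightarrow>
    (\<forall>i<D. i \<noteq> r \<longrightarrow> x i \<notin> K) \<longrightarrow> dirac_sum {..<D} c x \<in> measure_algebra \<longrightarrow>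
    dirac_sum {..<D::nat} c x \<in> U)" (is "\<exists>K. compact K \<and> ?near K U")
proof -
  have "generate_topology_on {{\<mu> \<in> measure_algebra. measure_integral \<mu> f \<in> V} | f V. f \<in> C0 \<and> open V} U"
    using assms(1) by (simp add: weak_star_topology_def openin_topology_generated_by_iff)
  then show ?thesis using assms(2)
  proof (induction rule: generate_topology_on.induct)
    case Empty
    then show ?case by simp
  next
    case (Int U V)
    then obtain K L where KL: "compact K" "?near K U" "compact L" "?near L V" by auto
    show ?case
    proof (intro exI[of _ "K \<union> L"] conjI allI impI)
      show "compact (K \<union> L)" using KL by (intro compact_Un)
    next
      fix c x r
      assume "r < D" "c r = 1" "x r = 0" "\<forall>i<D. norm (c i) \<le> 1" "\<forall>i<D. i \<noteq> r \<longrightarrow> x i \<notin> K \<union> L"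
        "dirac_sum {..<D} c x \<in> measure_algebra"
      then show "dirac_sum {..<D} c x \<in> U \<inter> V" using KL(2,4) by (metis IntI UnCI)
    qed
  next
    case (UN \<K>)
    then obtain V where V: "V \<in> \<K>" "dirac 0 \<in> V" by blast
    then obtain K where K: "compact K" "?near K V" using UN.IH by metis
    show ?case
    proof (intro exI[of _ K] conjI allI impI)
      fix c x r
      assume "r < D" "c r = 1" "x r = 0" "\<forall>i<D. norm (c i) \<le> 1" "\<forall>i<D. i \<noteq> r \<longrightarrow> x i \<notin> K"
        "dirac_sum {..<D} c x \<in> measure_algebra"
      then have "dirac_sum {..<D} c x \<in> V" using K(2) by metis
      then show "dirac_sum {..<D} c x \<in> \<Union>\<K>" using V by blast
    qed (rule K(1))
  next
    case (Basis U)
    then obtain f V where fV: "U = {\<mu> \<in> measure_algebra. measure_integral \<mu> f \<in> V}" "f \<in> C0" "open V"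
      by blast
    have f: "f \<in> borel_measurable borel"
      using fV(2) by (intro borel_measurable_continuous_onI) (simp add: C0_def)
    have "dirac 0 = dirac_sum {0::nat} (\<lambda>_. 1) (\<lambda>_. 0 :: 'a)"
      by (simp add: dirac_sum_def measure_scale_def)
    then have "measure_integral (dirac 0) f = f 0"
      using measure_integral_dirac_sum[of "{0::nat}" "\<lambda>_. 1" "\<lambda>_. 0 :: 'a" f] f dirac_measure_algebra[of "0 :: 'a"]
      by simp
    then have "f 0 \<in> V" using Basis fV by auto
    then obtain \<epsilon> where \<epsilon>: "\<epsilon> > 0" "ball (f 0) \<epsilon> \<subseteq> V" using fV(3) openE by blast
    show ?case
    proof (cases "D = 0")
      case True
      then show ?thesis by (intro exI[of _ "{}"]) auto
    next
      case False
      then have "\<epsilon> / D > 0" using \<epsilon>(1) by simp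
      then have "\<exists>K. compact K \<and> (\<forall>x. x \<notin> K \<longrightarrow> norm (f x) < \<epsilon> / D)"
        using fV(2) by (simp add: C0_def)
      then obtain K where K: "compact K" "\<And>x. x \<notin> K \<Longrightarrow> norm (f x) < \<epsilon> / D" by blast
      show ?thesis
      proof (intro exI[of _ K] conjI allI impI)
        fix c x r
        assume h: "r < D" "c r = 1" "x r = 0" "\<forall>i<D. norm (c i) \<le> 1" "\<forall>i<D. i \<noteq> r \<longrightarrow> x i \<notin> K"
          "dirac_sum {..<D} c x \<in> measure_algebra"
        have "measure_integral (dirac_sum {..<D} c x) f = (\<Sum>i<D. c i * f (x i))"
          by (rule measure_integral_dirac_sum[OF _ h(6) f]) simp
        also have "\<dots> = f 0 + (\<Sum>i\<in>{..<D} - {r}. c i * f (x i))"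
          using h by (subst sum.remove[of _ r]) auto
        finally have "norm (f 0 - measure_integral (dirac_sum {..<D} c x) f) = norm (\<Sum>i\<in>{..<D} - {r}. c i * f (x i))"
          by simp
        also have "\<dots> \<le> (\<Sum>i\<in>{..<D} - {r}. \<epsilon> / D)"
        proof (rule sum_norm_le)
          fix i assume i: "i \<in> {..<D} - {r}"
          have "norm (c i * f (x i)) \<le> 1 * norm (f (x i))"
            unfolding norm_mult using h i by (intro mult_right_mono) auto
          also have "\<dots> \<le> \<epsilon> / D" using K(2)[of "x i"] h i by auto
          finally show "norm (c i * f (x i)) \<le> \<epsilon> / D" .
        qed
        also have "\<dots> = real (D - 1) * (\<epsilon> / D)" using h by simp
        also have "\<dots> < \<epsilon>" using \<epsilon>(1) h(1) by (simp add: field_simps)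
        finally have "measure_integral (dirac_sum {..<D} c x) f \<in> V"
          using \<epsilon>(2) by (auto simp: dist_norm)
        then show "dirac_sum {..<D} c x \<in> U" using h fV by simp
      qed (rule K(1))
    qed
  qed
qed

text \<open>
  If the unit were not in \<open>J\<close>, the complement of \<open>J\<close> would be a weak* neighbourhood of it. A relation
  between widely separated point masses, translated so that its coefficient \<open>1\<close> sits at the neutral
  element, lies both in \<open>J\<close> and in this neighbourhood.
\<close>

lemma weak_star_closed_left_ideal_eq:
  fixes J :: "('a::{topological_group_add,t2_space} set \<Rightarrow> complex) set"
  assumes noncompact: "\<not> compact (UNIV :: 'a set)"
    and J: "left_ideal J" "finite_codimension J" "closedin weak_star_topology J"
  shows "J = measure_algebra"
proof (rule left_ideal_eq_measure_algebra[OF J(1)], rule ccontr)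
  assume not: "dirac 0 \<notin> J"
  have sub: "J \<subseteq> measure_algebra" "meas.subspace J" using J(1) by (auto simp: left_ideal_def)
  obtain B where B: "finite B" "measure_algebra \<subseteq> meas.span (J \<union> B)"
    using J(2) by (auto simp: finite_codimension_def)
  define D where "D = Suc (card B)"
  have top: "(dirac 0 :: 'a set \<Rightarrow> complex) \<in> topspace weak_star_topology"
  proof -
    have "(\<lambda>_::'a. 0::complex) \<in> C0" by (auto simp: C0_def intro: exI[of _ "{}"])
    then have "(measure_algebra :: ('a set \<Rightarrow> complex) set) \<in>
        {{\<mu> \<in> measure_algebra. measure_integral \<mu> f \<in> U} | f U. f \<in> C0 \<and> open U}"
      by (intro CollectI exI[of _ "\<lambda>_. 0"] exI[of _ UNIV]) auto
    then show ?thesis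
      using dirac_measure_algebra[of "0 :: 'a"] unfolding weak_star_topology_def topology_generated_by_topspace by blast
  qed
  then have "openin weak_star_topology (topspace weak_star_topology - J)" "dirac 0 \<in> topspace weak_star_topology - J"
    using J(3) not by auto
  from weak_star_neighbourhood_of_dirac_0[OF this, of D] obtain K where K: "compact K"
    and near: "\<forall>c x r. r < D \<longrightarrow> c r = 1 \<longrightarrow> x r = 0 \<longrightarrow> (\<forall>i<D. norm (c i) \<le> 1) \<longrightarrow>
      (\<forall>i<D. i \<noteq> r \<longrightarrow> x i \<notin> K) \<longrightarrow> dirac_sum {..<D} c x \<in> measure_algebra \<longrightarrow>
      dirac_sum {..<D} c x \<in> topspace weak_star_topology - J" by (elim exE conjE)
  from exists_separated_sequence[OF noncompact K]
  obtain x where x: "\<forall>l m :: nat. l \<noteq> m \<longrightarrow> - x l + x m \<notin> K" ..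
  have "\<exists>c r. r \<in> {..<D} \<and> c r = 1 \<and> (\<forall>i\<in>{..<D}. norm (c i) \<le> 1) \<and> dirac_sum {..<D} c x \<in> J"
    by (rule exists_dirac_sum_in_subspace[OF sub(2) B]) (simp_all add: D_def)
  then obtain c r where cr: "r \<in> {..<D}" "c r = 1" "\<forall>i\<in>{..<D}. norm (c i) \<le> 1"
    "dirac_sum {..<D} c x \<in> J" by (elim exE conjE)
  have "convolution (dirac (- x r)) (dirac_sum {..<D} c x) \<in> J"
    by (rule left_ideal_convolution[OF J(1) dirac_measure_algebra cr(4)])
  then have in_J: "dirac_sum {..<D} c (\<lambda>i. - x r + x i) \<in> J"
    using cr(4) sub(1) by (subst (asm) convolution_dirac_dirac_sum) auto
  have "dirac_sum {..<D} c (\<lambda>i. - x r + x i) \<in> topspace weak_star_topology - J"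
    using cr x in_J sub(1) by (intro near[rule_format, of r]) auto
  then show False using in_J by simp
qed

section \<open>Finitely generated closed left ideals of finite codimension\<close>

text \<open>
  Iterated collars around \<open>p\<close>. A point that \<open>K\<close> carries into \<open>halo K p l + K\<close> lies in
  \<open>halo K p (Suc l)\<close>, which is why one step adds \<open>K\<close> and then subtracts it.
\<close>

primrec halo :: "'a::group_add set \<Rightarrow> 'a \<Rightarrow> nat \<Rightarrow> 'a set" where
  "halo K p 0 = {p}"
| "halo K p (Suc l) = sumset (sumset (halo K p l) K) (uminus ` K)"

lemma compact_halo:
  fixes K :: "'a::topological_group_add set"
  shows "compact K \<Longrightarrow> compact (halo K p l)"
  by (induction l) (auto intro: compact_sumset compact_uminus_image)

lemma sumset_halo_subset: "0 \<in> K \<Longrightarrow> sumset (halo K p l) K \<subseteq> halo K p (Suc l)"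
  using sumsetI[of _ "sumset (halo K p l) K" 0 "uminus ` K"] by (force simp: image_iff)

lemma halo_subset_Suc: "0 \<in> K \<Longrightarrow> halo K p l \<subseteq> halo K p (Suc l)"
  using sumsetI[of _ "halo K p l" 0 K] sumset_halo_subset[of K p l] by fastforce

lemma halo_mono: "0 \<in> K \<Longrightarrow> l \<le> m \<Longrightarrow> halo K p l \<subseteq> halo K p m"
  by (rule lift_Suc_mono_le[of "halo K p"]) (rule halo_subset_Suc)

lemma centre_in_halo: "0 \<in> K \<Longrightarrow> p \<in> halo K p l"
  using halo_mono[of K 0 l p] by auto

lemma translate_halo: "y \<in> halo K p l \<Longrightarrow> - p + y \<in> halo K 0 l"
proof (induction l arbitrary: y)
  case (Suc l)
  then obtain w s t where y: "y = w + s + - t" "w \<in> halo K p l" "s \<in> K" "t \<in> K"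
    by (auto simp: sumset_def)
  have "(- p + w) + s + - t \<in> halo K 0 (Suc l)"
    unfolding halo.simps by (intro sumsetI imageI Suc.IH y)
  then show ?case by (simp only: y add.assoc)
qed auto

lemma not_in_sumset_halo:
  assumes "s \<notin> halo K p (Suc l)" "t \<in> K"
  shows "s + t \<notin> sumset (halo K p l) K"
proof
  assume "s + t \<in> sumset (halo K p l) K"
  then have "s + t + - t \<in> halo K p (Suc l)"
    unfolding halo.simps by (intro sumsetI[OF _ imageI] assms(2))
  then show False using assms(1) by (simp add: add.assoc)
qed

lemma exists_small_increment:
  fixes s :: "nat \<Rightarrow> real"
  assumes "0 < N" "s N - s 0 \<le> a"
  obtains l where "l < N" "s (Suc l) - s l \<le> a / N"
proof -
  have "\<exists>l<N. s (Suc l) - s l \<le> a / N"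
  proof (rule ccontr)
    assume "\<not> ?thesis"
    then have "(\<Sum>l<N. a / N) < (\<Sum>l<N. s (Suc l) - s l)"
      using assms(1) by (intro sum_strict_mono) auto
    also have "\<dots> = s N - s 0" by (rule sum_lessThan_telescope)
    finally show False using assms by simp
  qed
  then show ?thesis using that by blast
qed

text \<open>
  The collars between successive halos of \<open>p\<close> are disjoint, so by the pigeonhole principle one of
  the first \<open>N\<close> carries at most an \<open>N\<close>-th of the mass of the \<open>\<alpha> i\<close>. Cutting the \<open>\<alpha> i\<close> off along that
  collar cuts the sum of convolutions off as well, up to a small error, and what remains is the part
  of it near \<open>p\<close>, that is the single atom. The point of the lemma is that the restricted sum is again
  a combination of the \<open>\<mu> i\<close>.
\<close>

lemma isolate_atom:
  fixes \<alpha> \<mu> :: "nat \<Rightarrow> 'a::{topological_group_add,t2_space} set \<Rightarrow> complex"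
  assumes \<alpha>: "\<And>i. i < n \<Longrightarrow> \<alpha> i \<in> measure_algebra" and \<mu>: "\<And>i. i < n \<Longrightarrow> \<mu> i \<in> measure_algebra"
    and K: "compact K" "0 \<in> K" and tail: "\<And>i. i < n \<Longrightarrow> jordan_variation (\<mu> i) (- K) \<le> \<epsilon>"
    and N: "0 < N"
    and atom: "\<And>E. E \<in> sets borel \<Longrightarrow> (\<And>y. y \<in> E \<Longrightarrow> - p + y \<in> halo K 0 N) \<Longrightarrow>
      (\<Sum>i<n. convolution (\<alpha> i) (\<mu> i)) E = w * dirac p E"
  shows "\<exists>W\<in>sets borel. \<forall>E\<in>sets borel.
    norm (w * dirac p E - (\<Sum>i<n. convolution (restrict_measure W (\<alpha> i)) (\<mu> i)) E)
      \<le> \<epsilon> * (\<Sum>i<n. jordan_variation (\<alpha> i) UNIV)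
        + (\<Sum>i<n. jordan_variation (\<mu> i) UNIV) * ((\<Sum>i<n. jordan_variation (\<alpha> i) UNIV) / N)"
proof -
  define a where "a = (\<Sum>i<n. jordan_variation (\<alpha> i) UNIV)"
  define b where "b = (\<Sum>i<n. jordan_variation (\<mu> i) UNIV)"
  have cm: "complex_measure (\<alpha> i)" "complex_measure (\<mu> i)" if "i < n" for i
    using that \<alpha> \<mu> by (auto intro: complex_measure_of_measure_algebra)
  have closed_borel: "C \<in> sets borel" if "compact C" for C :: "'a set"
    using that by (intro borel_closed compact_imp_closed)
  note W_borel = closed_borel[OF compact_halo[OF K(1)]]
  have A_borel: "sumset (halo K p l) K \<in> sets borel" for l
    by (intro closed_borel compact_sumset compact_halo K)
  define s where "s l = (\<Sum>i<n. jordan_variation (\<alpha> i) (halo K p l))" for l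
  have "s N \<le> a" unfolding s_def a_def
    using complex_measure.jordan_variation_mono[OF cm(1)] by (intro sum_mono) auto
  moreover have "0 \<le> s 0" unfolding s_def
    using complex_measure.jordan_variation_nonneg[OF cm(1)] by (intro sum_nonneg) auto
  ultimately have "s N - s 0 \<le> a" by simp
  then obtain l where l: "l < N" "s (Suc l) - s l \<le> a / N"
    by (rule exists_small_increment[OF N])
  define W where "W = halo K p l"
  define W' where "W' = halo K p (Suc l)"
  define A where "A = sumset W K"
  have WW': "W \<subseteq> W'" unfolding W_def W'_def by (rule halo_subset_Suc[OF K(2)])
  have "(\<Sum>i<n. jordan_variation (\<alpha> i) (W' - W)) = s (Suc l) - s l"
    unfolding s_def sum_subtractf[symmetric]
    using complex_measure.jordan_variation_Diff[OF cm(1) W_borel W_borel halo_subset_Suc[OF K(2)]]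
    by (intro sum.cong refl) (simp add: W_def W'_def del: halo.simps)
  then have annulus: "(\<Sum>i<n. jordan_variation (\<alpha> i) (W' - W)) \<le> a / N" using l by simp
  have A_sub: "- p + y \<in> halo K 0 N" if "y \<in> A" for y
  proof -
    have "y \<in> halo K p N"
      using that sumset_halo_subset[OF K(2), of p l] halo_mono[OF K(2), of "Suc l" N p] l(1)
      by (auto simp: A_def W_def simp del: halo.simps)
    then show ?thesis by (rule translate_halo)
  qed
  have pA: "p \<in> A"
    using sumsetI[OF centre_in_halo[OF K(2), of p l] K(2)] by (simp add: A_def W_def)
  have bound: "norm (w * dirac p E - (\<Sum>i<n. convolution (restrict_measure W (\<alpha> i)) (\<mu> i)) E) \<le> \<epsilon> * a + b * (a / N)"
    if E: "E \<in> sets borel" for E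
  proof -
    have EA: "E \<inter> A \<in> sets borel" using E A_borel by (simp add: A_def W_def)
    have "w * dirac p E = w * dirac p (E \<inter> A)"
      using E EA pA by (simp add: dirac_def indicator_def)
    also have "\<dots> = (\<Sum>i<n. convolution (\<alpha> i) (\<mu> i)) (E \<inter> A)"
      using EA A_sub by (intro atom[symmetric]) auto
    finally have "norm (w * dirac p E - (\<Sum>i<n. convolution (restrict_measure W (\<alpha> i)) (\<mu> i)) E)
      = norm (\<Sum>i<n. convolution (restrict_measure W (\<alpha> i)) (\<mu> i) E - convolution (\<alpha> i) (\<mu> i) (E \<inter> A))"
      by (simp add: sum_fun_apply sum_subtractf norm_minus_commute)
    also have "\<dots> \<le> (\<Sum>i<n. \<epsilon> * jordan_variation (\<alpha> i) UNIV + b * jordan_variation (\<alpha> i) (W' - W))"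
    proof (rule sum_norm_le)
      fix i assume "i \<in> {..<n}"
      then have i: "i < n" by simp
      have "norm (convolution (restrict_measure W (\<alpha> i)) (\<mu> i) E - convolution (\<alpha> i) (\<mu> i) (E \<inter> A))
        \<le> \<epsilon> * jordan_variation (\<alpha> i) UNIV + jordan_variation (\<mu> i) UNIV * jordan_variation (\<alpha> i) (W' - W)"
      proof (rule convolution_truncation[OF \<alpha>[OF i] \<mu>[OF i] _ _ _ closed_borel[OF K(1)] E _ _ tail[OF i]])
        show "W \<in> sets borel" "W' \<in> sets borel" "A \<in> sets borel"
          unfolding W_def W'_def A_def by (rule W_borel A_borel)+
        show "s + t \<in> A" if "s \<in> W" "t \<in> K" for s t using that by (simp add: A_def sumsetI)
        show "s + t \<notin> A" if "s \<notin> W'" "t \<in> K" for s t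
          using not_in_sumset_halo that unfolding A_def W_def W'_def by blast
      qed
      also have "jordan_variation (\<mu> i) UNIV \<le> b"
        unfolding b_def using i complex_measure.jordan_variation_nonneg[OF cm(2)]
        by (intro member_le_sum) auto
      finally show "norm (convolution (restrict_measure W (\<alpha> i)) (\<mu> i) E - convolution (\<alpha> i) (\<mu> i) (E \<inter> A))
        \<le> \<epsilon> * jordan_variation (\<alpha> i) UNIV + b * jordan_variation (\<alpha> i) (W' - W)"
        using complex_measure.jordan_variation_nonneg[OF cm(1)[OF i]] by (simp add: mult_right_mono)
    qed
    also have "\<dots> = \<epsilon> * a + b * (\<Sum>i<n. jordan_variation (\<alpha> i) (W' - W))"
      by (simp add: sum.distrib sum_distrib_left a_def)
    also have "\<dots> \<le> \<epsilon> * a + b * (a / N)"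
    proof -
      have "0 \<le> b" unfolding b_def
        using complex_measure.jordan_variation_nonneg[OF cm(2)] by (intro sum_nonneg) auto
      then show ?thesis by (intro add_left_mono mult_left_mono annulus)
    qed
    finally show ?thesis .
  qed
  show ?thesis
    using W_borel[of p l] bound unfolding a_def b_def W_def by blast
qed

lemma norm_closed_approximation:
  fixes J :: "('a::topological_space set \<Rightarrow> complex) set"
  assumes J: "closedin norm_topology J" and \<nu>: "\<nu> \<in> measure_algebra"
    and approx: "\<And>e. e > 0 \<Longrightarrow> \<exists>\<sigma>\<in>J. \<forall>E\<in>sets borel. norm (\<nu> E - \<sigma> E) \<le> e"
  shows "\<nu> \<in> J"
proof (rule ccontr)
  interpret M: Metric_space "measure_algebra :: ('a set \<Rightarrow> complex) set" "\<lambda>\<mu> \<nu>. tv_norm (\<mu> - \<nu>)"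
    by (rule Metric_space_measure_algebra)
  assume "\<nu> \<notin> J"
  then obtain r where r: "r > 0" "disjnt J (M.mball \<nu> r)" and sub: "J \<subseteq> measure_algebra"
    using J \<nu> unfolding norm_topology_def M.closedin_metric by blast
  \<comment> \<open>A setwise bound costs a factor \<open>4\<close> in the norm.\<close>
  obtain \<sigma> where \<sigma>: "\<sigma> \<in> J" "\<And>E. E \<in> sets borel \<Longrightarrow> norm (\<nu> E - \<sigma> E) \<le> r / 8"
    using approx[of "r / 8"] r(1) by auto
  have "\<sigma> \<in> measure_algebra" using \<sigma>(1) sub by blast
  interpret complex_measure "\<nu> - \<sigma>"
    using \<nu> \<open>\<sigma> \<in> measure_algebra\<close>
    by (simp add: complex_measure_def measure_algebra_def complex_borel_measure_diff)
  have "tv_norm (\<nu> - \<sigma>) \<le> 4 * (r / 8)" using \<sigma>(2) by (intro tv_norm_le) simp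
  also have "\<dots> < r" using r(1) by simp
  finally have "\<sigma> \<in> M.mball \<nu> r" using \<nu> \<open>\<sigma> \<in> measure_algebra\<close> by (simp add: M.in_mball)
  then show False using r(2) \<sigma>(1) by (auto simp: disjnt_iff)
qed

text \<open>
  Tightness, for finitely many measures at once; \<open>0\<close> is put into \<open>K\<close> to make the halos increase.
\<close>

lemma exists_compact_small_tails:
  fixes \<mu> :: "nat \<Rightarrow> 'a::{zero,t2_space} set \<Rightarrow> complex"
  assumes \<mu>: "\<And>i. i < n \<Longrightarrow> \<mu> i \<in> measure_algebra" and \<epsilon>: "\<epsilon> > 0"
  shows "\<exists>K. compact K \<and> 0 \<in> K \<and> (\<forall>i<n. jordan_variation (\<mu> i) (- K) \<le> \<epsilon>)"
proof -
  have "\<exists>K. i < n \<longrightarrow> compact K \<and> jordan_variation (\<mu> i) (- K) < \<epsilon>" for i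
  proof (cases "i < n")
    case True
    obtain K U where KU: "compact K" "open U" "K \<subseteq> UNIV" "UNIV \<subseteq> U" "jordan_variation (\<mu> i) (U - K) < \<epsilon>"
      by (rule measure_algebra_approximation[OF \<mu>[OF True] _ \<epsilon>, of UNIV]) simp
    then have "U - K = - K" by auto
    then show ?thesis using KU by auto
  qed simp
  then obtain K where "\<And>i. i < n \<longrightarrow> compact (K i) \<and> jordan_variation (\<mu> i) (- K i) < \<epsilon>"
    using choice[of "\<lambda>i K. i < n \<longrightarrow> compact K \<and> jordan_variation (\<mu> i) (- K) < \<epsilon>"] by blast
  then have K: "\<And>i. i < n \<Longrightarrow> compact (K i)" "\<And>i. i < n \<Longrightarrow> jordan_variation (\<mu> i) (- K i) < \<epsilon>"
    by simp_all
  define L where "L = insert 0 (\<Union>i<n. K i)"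
  have L: "compact L" unfolding L_def using K(1) by (intro compact_insert compact_UN) auto
  have "jordan_variation (\<mu> i) (- L) \<le> \<epsilon>" if i: "i < n" for i
  proof -
    interpret complex_measure "\<mu> i" by (rule complex_measure_of_measure_algebra[OF \<mu>[OF i]])
    have "- K i \<in> sets borel" using K(1)[OF i] by (intro borel_open open_Compl compact_imp_closed)
    then have "jordan_variation (\<mu> i) (- L) \<le> jordan_variation (\<mu> i) (- K i)"
      using i by (intro jordan_variation_mono) (auto simp: L_def)
    then show ?thesis using K(2)[OF i] by simp
  qed
  then show ?thesis using L by (intro exI[of _ L]) (auto simp: L_def)
qed

text \<open>
  A gliding hump argument. The atoms are arranged in blocks of length \<open>D\<close>, one more than the
  codimension, and in block \<open>k\<close> a relation modulo \<open>J\<close> is placed with the weight \<open>w k\<close>. The tolerances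
  \<open>\<epsilon> k\<close>, the compact sets \<open>K k\<close> and the numbers \<open>N k\<close> of collars are fixed in advance relative to
  \<open>w k\<close>, and only then are the points separated accordingly. They do not involve the coefficients
  \<open>\<alpha> i\<close> that represent the sum \<open>j\<close> of all blocks; the total mass \<open>a\<close> of these is finite, which is
  enough because \<open>\<epsilon> k\<close> tends to \<open>0\<close> faster than \<open>w k\<close>.
\<close>

lemma finitely_generated_closed_left_ideal_eq:
  fixes J :: "('a::{topological_group_add,t2_space} set \<Rightarrow> complex) set"
  assumes noncompact: "\<not> compact (UNIV :: 'a set)"
    and J: "left_ideal J" "finite_codimension J" "finitely_generated J" "closedin norm_topology J"
  shows "J = measure_algebra"
proof -
  have sub: "J \<subseteq> measure_algebra" "meas.subspace J" using J(1) by (auto simp: left_ideal_def)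
  obtain B where B: "finite B" "measure_algebra \<subseteq> meas.span (J \<union> B)"
    using J(2) by (auto simp: finite_codimension_def)
  obtain n :: nat and \<mu> where \<mu>_J: "\<forall>i<n. \<mu> i \<in> J"
    and J_eq: "J = {\<Sum>i<n. convolution (\<alpha> i) (\<mu> i) | \<alpha>. \<forall>i<n. \<alpha> i \<in> measure_algebra}"
    using J(3) unfolding finitely_generated_def by (elim exE conjE)
  have \<mu>: "\<mu> i \<in> measure_algebra" if "i < n" for i using \<mu>_J sub(1) that by blast
  define D where "D = Suc (card B)"
  have D: "D > 0" by (simp add: D_def)
  \<comment> \<open>\<open>w\<close> decays per block as \<open>2\<close> to the minus block length, so that the coefficient of the \<open>m\<close>-th atom is at most \<open>(1/2)^m\<close>.\<close>
  define w :: "nat \<Rightarrow> real" where "w k = (1 / 2) ^ (Suc k * D)" for k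
  define \<epsilon> where "\<epsilon> k = w k / real (Suc k)" for k
  have w_pos: "w k > 0" for k by (simp add: w_def)
  have \<epsilon>_pos: "\<epsilon> k > 0" for k using w_pos by (simp add: \<epsilon>_def)
  have "\<forall>k. \<exists>K. compact K \<and> 0 \<in> K \<and> (\<forall>i<n. jordan_variation (\<mu> i) (- K) \<le> \<epsilon> k)"
    by (intro allI exists_compact_small_tails \<mu> \<epsilon>_pos)
  from choice[OF this] obtain K
    where "\<forall>k. compact (K k) \<and> 0 \<in> K k \<and> (\<forall>i<n. jordan_variation (\<mu> i) (- K k) \<le> \<epsilon> k)" ..
  then have K: "\<And>k. compact (K k)" "\<And>k. 0 \<in> K k"
    and tail: "\<And>k i. i < n \<Longrightarrow> jordan_variation (\<mu> i) (- K k) \<le> \<epsilon> k" by simp_all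
  have "\<forall>k. \<exists>N. 0 < N \<and> 1 / real N < \<epsilon> k"
  proof
    fix k
    show "\<exists>N. 0 < N \<and> 1 / real N < \<epsilon> k"
      using reals_Archimedean[OF \<epsilon>_pos[of k]] by (auto simp: inverse_eq_divide simp del: of_nat_Suc)
  qed
  from choice[OF this] obtain N :: "nat \<Rightarrow> nat" where "\<forall>k. 0 < N k \<and> 1 / real (N k) < \<epsilon> k" ..
  then have N: "\<And>k. 0 < N k" "\<And>k. 1 / real (N k) < \<epsilon> k" by simp_all
  have "\<exists>x. \<forall>l m. l \<noteq> m \<longrightarrow> - x l + x m \<notin> halo (K (l div D)) 0 (N (l div D))"
    by (rule exists_separated_sequence[OF noncompact]) (intro compact_halo K)
  then obtain x where x: "\<forall>l m. l \<noteq> m \<longrightarrow> - x l + x m \<notin> halo (K (l div D)) 0 (N (l div D))" ..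
  define I where "I k = {k * D..<Suc k * D}" for k
  have block: "m div D = k" if "m \<in> I k" for m k
    using that D by (intro div_nat_eqI) (auto simp: I_def mult.commute)
  have "\<forall>k. \<exists>c r. r \<in> I k \<and> c r = 1 \<and> (\<forall>i\<in>I k. norm (c i) \<le> 1) \<and> dirac_sum (I k) c x \<in> J"
  proof
    fix k
    show "\<exists>c r. r \<in> I k \<and> c r = 1 \<and> (\<forall>i\<in>I k. norm (c i) \<le> 1) \<and> dirac_sum (I k) c x \<in> J"
      by (rule exists_dirac_sum_in_subspace[OF sub(2) B]) (simp_all add: I_def D_def)
  qed
  from choice[OF this] obtain c where
    "\<forall>k. \<exists>r. r \<in> I k \<and> c k r = 1 \<and> (\<forall>i\<in>I k. norm (c k i) \<le> 1) \<and> dirac_sum (I k) (c k) x \<in> J" ..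
  from choice[OF this] obtain r where
    "\<forall>k. r k \<in> I k \<and> c k (r k) = 1 \<and> (\<forall>i\<in>I k. norm (c k i) \<le> 1) \<and> dirac_sum (I k) (c k) x \<in> J" ..
  then have r: "\<And>k. r k \<in> I k" "\<And>k. c k (r k) = 1"
    and c: "\<And>k i. i \<in> I k \<Longrightarrow> norm (c k i) \<le> 1" and h: "\<And>k. dirac_sum (I k) (c k) x \<in> J" by simp_all
  define b where "b m = of_real (w (m div D)) * c (m div D) m" for m
  have mem_block: "m \<in> I (m div D)" for m
    using dividend_less_div_times[OF D, of m] by (simp add: I_def algebra_simps)
  have norm_b: "norm (b m) \<le> (1 / 2) ^ m" for m
  proof -
    have "norm (b m) = w (m div D) * norm (c (m div D) m)"
      using w_pos[of "m div D"] by (simp add: b_def norm_mult)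
    also have "\<dots> \<le> w (m div D) * 1"
      using w_pos[of "m div D"] c[OF mem_block] by (intro mult_left_mono) auto
    also have "\<dots> \<le> (1 / 2) ^ m"
      using mem_block[of m] by (auto simp: w_def I_def intro!: power_decreasing simp del: mult_Suc)
    finally show ?thesis .
  qed
  have summable_b: "summable (\<lambda>m. norm (b m))"
    by (rule summable_comparison_test'[of "\<lambda>m. (1 / 2) ^ m" 0]) (use norm_b in \<open>auto intro: summable_geometric\<close>)
  define j where "j = atomic b x"
  have j_M: "j \<in> measure_algebra" unfolding j_def by (rule atomic_measure_algebra[OF summable_b])
  \<comment> \<open>The blocks lie in \<open>J\<close>, and the partial sums over blocks converge to \<open>j\<close> in norm.\<close>
  have "j \<in> J"
  proof (rule norm_closed_approximation[OF J(4) j_M])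
    fix e :: real assume "e > 0"
    have "(\<lambda>M. \<Sum>m. norm (b (m + M))) \<longlonglongrightarrow> 0"
      using summable_b by (rule suminf_exist_split2)
    then have "\<forall>\<^sub>F M in sequentially. (\<Sum>m. norm (b (m + M))) < e"
      using \<open>e > 0\<close> by (intro order_tendstoD) auto
    then obtain M where M: "\<And>M'. M' \<ge> M \<Longrightarrow> (\<Sum>m. norm (b (m + M'))) < e"
      by (auto simp: eventually_sequentially)
    define \<sigma> where "\<sigma> = (\<Sum>k<M. measure_scale (of_real (w k)) (dirac_sum (I k) (c k) x))"
    have "\<sigma> \<in> J"
      unfolding \<sigma>_def using h by (intro meas.subspace_sum[OF sub(2)] meas.subspace_scale[OF sub(2)])
    moreover have "norm (j E - \<sigma> E) \<le> e" if E: "E \<in> sets borel" for E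
    proof -
      have "\<sigma> E = (\<Sum>k<M. \<Sum>m\<in>I k. b m * indicator E (x m))"
        unfolding \<sigma>_def sum_fun_apply measure_scale_def dirac_sum_apply sum_distrib_left
        using E block by (intro sum.cong refl) (simp add: b_def dirac_def)
      also have "\<dots> = (\<Sum>m<M * D. b m * indicator E (x m))"
        unfolding I_def mult_Suc add.commute[of D] by (rule sum.nat_group)
      finally have "norm (j E - \<sigma> E) \<le> (\<Sum>m. norm (b (m + M * D)))"
        using norm_atomic_minus_partial_sum_le[OF summable_b E, of x "M * D"] by (simp add: j_def)
      also have "\<dots> \<le> e" using M[of "M * D"] D by (simp add: less_imp_le)
      finally show ?thesis .
    qed
    ultimately show "\<exists>\<sigma>\<in>J. \<forall>E\<in>sets borel. norm (j E - \<sigma> E) \<le> e" by blast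
  qed
  then obtain \<alpha> where j_eq: "j = (\<Sum>i<n. convolution (\<alpha> i) (\<mu> i))" and \<alpha>: "\<And>i. i < n \<Longrightarrow> \<alpha> i \<in> measure_algebra"
    unfolding J_eq by auto
  define a where "a = (\<Sum>i<n. jordan_variation (\<alpha> i) UNIV)"
  define d where "d = (\<Sum>i<n. jordan_variation (\<mu> i) UNIV)"
  have nonneg: "0 \<le> a" "0 \<le> d"
    unfolding a_def d_def using \<alpha> \<mu>
    by (auto intro!: sum_nonneg complex_measure.jordan_variation_nonneg complex_measure_of_measure_algebra)
  have "dirac 0 \<in> J"
  proof (rule norm_closed_approximation[OF J(4) dirac_measure_algebra])
    fix e :: real assume e: "e > 0"
    obtain k where "a * (1 + d) / e < real k" using reals_Archimedean2 by blast
    then have k: "a * (1 + d) / e < real (Suc k)" by simp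
    define p where "p = x (r k)"
    have rk: "r k div D = k" by (rule block[OF r(1)])
    \<comment> \<open>By separation, \<open>j\<close> has no atom other than \<open>p\<close> in the region where the cut takes place.\<close>
    have atom: "(\<Sum>i<n. convolution (\<alpha> i) (\<mu> i)) E = of_real (w k) * dirac p E"
      if E: "E \<in> sets borel" "\<And>y. y \<in> E \<Longrightarrow> - p + y \<in> halo (K k) 0 (N k)" for E
    proof -
      have "x m \<notin> E" if "m \<noteq> r k" for m
        using x[rule_format, of "r k" m] E(2)[of "x m"] that by (auto simp: p_def rk)
      then have "(\<Sum>m. b m * indicator E (x m)) = (\<Sum>m\<in>{r k}. b m * indicator E (x m))"
        by (intro suminf_finite) auto
      also have "\<dots> = b (r k) * indicator E p" unfolding p_def by (subst sum.insert) auto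
      finally have "(\<Sum>m. b m * indicator E (x m)) = b (r k) * indicator E p" .
      then show ?thesis
        using E(1) r(2)[of k] unfolding j_eq[symmetric] j_def atomic_def by (simp add: b_def rk dirac_def)
    qed
    have "\<exists>W\<in>sets borel. \<forall>E\<in>sets borel.
        norm (of_real (w k) * dirac p E - (\<Sum>i<n. convolution (restrict_measure W (\<alpha> i)) (\<mu> i)) E)
          \<le> \<epsilon> k * a + d * (a / N k)"
      unfolding a_def d_def by (rule isolate_atom[OF \<alpha> \<mu> K(1) K(2) tail N(1) atom])
    then obtain W where W: "W \<in> sets borel"
      and close: "\<And>E. E \<in> sets borel \<Longrightarrow>
        norm (of_real (w k) * dirac p E - (\<Sum>i<n. convolution (restrict_measure W (\<alpha> i)) (\<mu> i)) E)
          \<le> \<epsilon> k * a + d * (a / N k)" by (elim bexE) auto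
    define \<nu> where "\<nu> = (\<Sum>i<n. convolution (restrict_measure W (\<alpha> i)) (\<mu> i))"
    have "\<nu> \<in> J"
      unfolding \<nu>_def J_eq by (intro CollectI exI[of _ "\<lambda>i. restrict_measure W (\<alpha> i)"])
        (simp add: restrict_measure_algebra[OF \<alpha> W])
    \<comment> \<open>Move the atom to the neutral element and rescale it to mass \<open>1\<close>; the error is multiplied by \<open>1 / w k\<close>.\<close>
    define \<sigma> where "\<sigma> = measure_scale (of_real (1 / w k)) (convolution (dirac (- p)) \<nu>)"
    have "\<sigma> \<in> J"
      unfolding \<sigma>_def
      by (intro meas.subspace_scale[OF sub(2)] left_ideal_convolution[OF J(1)] dirac_measure_algebra \<open>\<nu> \<in> J\<close>)
    moreover have "norm (dirac 0 E - \<sigma> E) \<le> e" if E: "E \<in> sets borel" for E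
    proof -
      define F where "F = {t. - p + t \<in> E}"
      have F: "F \<in> sets borel" unfolding F_def by (rule borel_translate[OF E])
      have "\<sigma> E = of_real (1 / w k) * \<nu> F"
        using E sub(1) \<open>\<nu> \<in> J\<close> by (simp add: \<sigma>_def measure_scale_def convolution_dirac_left F_def subsetD)
      moreover have "dirac 0 E = of_real (1 / w k) * (of_real (w k) * dirac p F)"
        using E F w_pos[of k] by (simp add: dirac_def F_def indicator_def)
      ultimately have "norm (dirac 0 E - \<sigma> E) = norm (of_real (1 / w k) * (of_real (w k) * dirac p F - \<nu> F))"
        by (simp only: right_diff_distrib)
      also have "\<dots> = 1 / w k * norm (of_real (w k) * dirac p F - \<nu> F)"
        using w_pos[of k] by (simp add: norm_mult norm_divide)
      also have "\<dots> \<le> 1 / w k * (\<epsilon> k * a + d * (a / N k))"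
        using close[OF F] w_pos[of k] by (intro mult_left_mono) (auto simp: \<nu>_def)
      also have "\<dots> \<le> 1 / w k * (\<epsilon> k * a + d * (a * \<epsilon> k))"
      proof -
        have "a / N k \<le> a * \<epsilon> k"
          using N(2)[of k] nonneg(1) mult_left_mono[of "1 / N k" "\<epsilon> k" a] by simp
        then show ?thesis
          using nonneg(2) w_pos[of k] by (intro mult_left_mono add_left_mono) auto
      qed
      also have "\<dots> = a * (1 + d) / real (Suc k)"
      proof -
        have "1 / w k * \<epsilon> k = 1 / real (Suc k)" using w_pos[of k] by (simp add: \<epsilon>_def del: of_nat_Suc)
        moreover have "1 / w k * (\<epsilon> k * a + d * (a * \<epsilon> k)) = (1 / w k * \<epsilon> k) * (a * (1 + d))"
          by (simp only: distrib_left mult.assoc mult.commute mult.left_commute mult_1_right)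
        ultimately show ?thesis by (simp del: of_nat_Suc)
      qed
      also have "\<dots> \<le> e"
        using less_imp_le[OF k] e by (simp add: pos_divide_le_eq mult.commute del: of_nat_Suc)
      finally show ?thesis .
    qed
    ultimately show "\<exists>\<sigma>\<in>J. \<forall>E\<in>sets borel. norm (dirac 0 E - \<sigma> E) \<le> e" by blast
  qed
  then show ?thesis by (rule left_ideal_eq_measure_algebra[OF J(1)])
qed

theorem corollary3p3:
  assumes "locally_compact_group TYPE('a::{topological_group_add,t2_space})"
    and "\<not> compact (UNIV :: 'a set)"
  shows "(\<nexists>J :: ('a set \<Rightarrow> complex) set.
            left_ideal J \<and> J \<noteq> measure_algebra \<and>
            closedin weak_star_topology J \<and> finite_codimension J) \<and>
         (\<nexists>J :: ('a set \<Rightarrow> complex) set.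
            left_ideal J \<and> J \<noteq> measure_algebra \<and>
            finitely_generated J \<and> closedin norm_topology J \<and> finite_codimension J)"
  using weak_star_closed_left_ideal_eq[OF assms(2)] finitely_generated_closed_left_ideal_eq[OF assms(2)] by blast

end
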